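(* Let $t\geq 14$, $m\geq t+1$ and $n\geq t$ be integers. If $\mathcal{A}$ and $\mathcal{B}$ are cross $t$-intersecting families of integer sequences in $[m]^n$, then $|\mathcal{A}||\mathcal{B}|\leq(m^{n-t})^2$. Equality holds if and only if either $\mathcal{A}=\mathcal{B}\cong\mathcal{H}_0^t(n)$, or $m=t+1$ and $\mathcal{A}=\mathcal{B}\cong\mathcal{H}_1^t(n)$.
   Context: $[m]^n$ is the set of sequences $(a_1,\dots,a_n)$ with $a_i\in\{1,\dots,m\}$. Two families $\mathcal{A},\mathcal{B}\subset[m]^n$ are cross $t$-intersecting if $\#\{i:a_i=b_i\}\geq t$ for all $(a_1,\dots,a_n)\in\mathcal{A}$ and $(b_1,\dots,b_n)\in\mathcal{B}$. They are isomorphic ($\mathcal{A}\cong\mathcal{B}$) if there are permutations $f_1,\dots,f_n$ of $[m]$ and a permutation $g$ of $[n]$ such that $\{(f_1(a_1),\dots,f_n(a_n)):(a_1,\dots,a_n)\in\mathcal{A}\}=\{(b_{g(1)},\dots,b_{g(n)}):(b_1,\dots,b_n)\in\mathcal{B}\}$. Let $\sigma:[m]^n\to 2^{[n]}$, $\sigma((a_1,\dots,a_n))=\{i:a_i=1\}$, and $\mathcal{H}_i^t(n)=\{a\in[m]^n:\sigma(a)\in\mathcal{F}_i^t(n)\}$, where $\mathcal{F}_i^t(n)=\{F\subset[n]:|F\cap[t+2i]|\geq t+i\}$.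
   Formalization: The second equality case (m = t+1 and A = B ≅ H_1^t(n)) is stated with the added condition n ≥ t+2; for n = t or n = t+1 the family H_1^t(n) is empty or a single sequence, so equality fails there. *)

theory Defs
  imports Main "HOL-Library.FuncSet" "HOL-Combinatorics.Permutations"
begin

text \<open>
  A sequence \<open>(a\<^sub>1, \<dots>, a\<^sub>n)\<close> is an extensional function on \<open>{1..n}\<close>, so that equality of
  sequences and cardinalities of families are the intended ones.
\<close>

definition seqs :: "nat \<Rightarrow> nat \<Rightarrow> (nat \<Rightarrow> nat) set" where
  "seqs m n = {1..n} \<rightarrow>\<^sub>E {1..m}"

definition cross_intersecting ::
    "nat \<Rightarrow> nat \<Rightarrow> (nat \<Rightarrow> nat) set \<Rightarrow> (nat \<Rightarrow> nat) set \<Rightarrow> bool" where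
  "cross_intersecting t n A B \<longleftrightarrow> (\<forall>a\<in>A. \<forall>b\<in>B. card {i \<in> {1..n}. a i = b i} \<ge> t)"

definition isomorphic ::
    "nat \<Rightarrow> nat \<Rightarrow> (nat \<Rightarrow> nat) set \<Rightarrow> (nat \<Rightarrow> nat) set \<Rightarrow> bool" where
  "isomorphic m n A B \<longleftrightarrow>
     (\<exists>f g. (\<forall>i\<in>{1..n}. f i permutes {1..m}) \<and> g permutes {1..n} \<and>
        (\<lambda>a. \<lambda>i\<in>{1..n}. f i (a i)) ` A = (\<lambda>b. \<lambda>i\<in>{1..n}. b (g i)) ` B)"

definition sigma :: "nat \<Rightarrow> (nat \<Rightarrow> nat) \<Rightarrow> nat set" where
  "sigma n a = {i \<in> {1..n}. a i = 1}"

text \<open>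
  The family \<open>frankl_family i t n\<close> is the usual Frankl family only when \<open>t + 2 * i \<le> n\<close>; otherwise
  \<open>{1..t + 2 * i}\<close> is not contained in the ground set \<open>{1..n}\<close>.
\<close>

definition frankl_family :: "nat \<Rightarrow> nat \<Rightarrow> nat \<Rightarrow> nat set set" where
  "frankl_family i t n = {F. F \<subseteq> {1..n} \<and> card (F \<inter> {1..t + 2 * i}) \<ge> t + i}"

definition frankl_seqs :: "nat \<Rightarrow> nat \<Rightarrow> nat \<Rightarrow> nat \<Rightarrow> (nat \<Rightarrow> nat) set" where
  "frankl_seqs m i t n = {a \<in> seqs m n. sigma n a \<in> frankl_family i t n}"

end

theory Submission imports Defs begin

text \<open>
  Replacing, coordinate by coordinate, the value \<open>v\<close> by \<open>1\<close> wherever this does not lead to a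
  member of the family keeps the families cross \<open>t\<close>-intersecting, and in the end even the sets
  \<open>\<sigma> a\<close> and \<open>\<sigma> b\<close> meet in \<open>t\<close> points.  This reduces the problem to cross \<open>t\<close>-intersecting
  families of subsets of \<open>{1..n}\<close>, where \<open>E\<close> is weighted by the number \<open>(m - 1) ^ (n - card E)\<close>
  of sequences \<open>a\<close> with \<open>\<sigma> a = E\<close>.

  Take an optimal pair of such families that is moreover left-shifted, and let \<open>l\<close> be the last
  coordinate on which it depends.  Members \<open>E\<close>, \<open>F\<close> for which \<open>l\<close> is pivotal and which meet in
  exactly \<open>t\<close> points of \<open>{1..l}\<close> cover \<open>{1..l}\<close>.  So one may drop the pivotal members of size \<open>i\<close>
  (within \<open>{1..l}\<close>) from one family and delete \<open>l\<close> from those of size \<open>j = l + t - i\<close> in the other.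
  Since neither this exchange nor its mirror image increases the product of the weights, the
  pivotal layers carry almost all of the weight; but shifting a pivotal member produces
  non-pivotal ones, and comparing the two gives \<open>(m - 2) * (l - i) \<le> i\<close> and
  \<open>(m - 2) * (l - j) \<le> j\<close>, hence \<open>l \<le> t + 2\<close>.  The remaining families are small enough to be
  treated by hand.  For uniqueness, all compressions are undone one at a time.
\<close>

section \<open>Compressions\<close>

text \<open>Common form of the two operations used below. \<open>\<phi>\<close> exchanges
  \<open>D\<close>, the elements to be pushed, with its image and fixes everything else;
  \<open>s\<close> is the size of an intersection. The assumption \<open>gain\<close> concerns two
  elements that are already in pushed position: pulling one of them back cannot increase
  \<open>s\<close>.\<close>

locale compression =
  fixes \<phi> :: "'a \<Rightarrow> 'a" and D :: "'a set" and s :: "'a \<Rightarrow> 'a \<Rightarrow> nat"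
  assumes invol [simp]: "\<phi> (\<phi> x) = x"
    and moved: "x \<in> D \<Longrightarrow> \<phi> x \<notin> D"
    and unmoved: "x \<notin> D \<Longrightarrow> \<phi> x \<notin> D \<Longrightarrow> \<phi> x = x"
    and invariant: "s (\<phi> x) (\<phi> y) = s x y"
    and commute: "s x y = s y x"
    and gain: "\<phi> x \<in> D \<Longrightarrow> \<phi> y \<in> D \<Longrightarrow> s x (\<phi> y) \<le> s x y"
begin

definition move :: "'a set \<Rightarrow> 'a \<Rightarrow> 'a" where
  "move A x = (if x \<in> D \<and> \<phi> x \<notin> A then \<phi> x else x)"

definition comp :: "'a set \<Rightarrow> 'a set" where
  "comp A = move A ` A"

lemma inj_move: "inj_on (move A) A"
  by (rule inj_onI) (metis move_def invol)

lemma comp_dom: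
  assumes "x \<in> D"
  shows "x \<in> comp A \<longleftrightarrow> x \<in> A \<and> \<phi> x \<in> A"
proof
  assume "x \<in> comp A"
  then obtain y where "y \<in> A" "x = move A y" by (auto simp: comp_def)
  then show "x \<in> A \<and> \<phi> x \<in> A"
    using assms moved by (auto simp: move_def split: if_splits)
next
  assume "x \<in> A \<and> \<phi> x \<in> A"
  then have "x = move A x" "x \<in> A" by (auto simp: move_def)
  then show "x \<in> comp A" unfolding comp_def by (rule image_eqI)
qed

lemma comp_img:
  assumes "\<phi> x \<in> D"
  shows "x \<in> comp A \<longleftrightarrow> x \<in> A \<or> \<phi> x \<in> A"
proof
  assume "x \<in> comp A"
  then obtain y where "y \<in> A" "x = move A y" by (auto simp: comp_def)
  then show "x \<in> A \<or> \<phi> x \<in> A"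
    by (auto simp: move_def split: if_splits)
next
  assume "x \<in> A \<or> \<phi> x \<in> A"
  moreover have "x = move A x" using moved[OF assms] by (auto simp: move_def)
  moreover have "x = move A (\<phi> x)" if "x \<notin> A" using that assms by (auto simp: move_def)
  ultimately show "x \<in> comp A" unfolding comp_def by (metis image_eqI)
qed

lemma comp_fixed:
  assumes "x \<notin> D" "\<phi> x \<notin> D"
  shows "x \<in> comp A \<longleftrightarrow> x \<in> A"
proof
  assume "x \<in> comp A"
  then obtain y where "y \<in> A" "x = move A y" by (auto simp: comp_def)
  then show "x \<in> A"
    using assms by (auto simp: move_def split: if_splits)
next
  assume "x \<in> A"
  moreover have "x = move A x" using assms by (auto simp: move_def)
  ultimately show "x \<in> comp A" unfolding comp_def by (metis image_eqI)
qed

lemma comp_subset: "A \<subseteq> U \<Longrightarrow> \<phi> ` U \<subseteq> U \<Longrightarrow> comp A \<subseteq> U"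
  unfolding comp_def move_def by auto

lemma sum_comp:
  assumes "\<And>x. w (\<phi> x) = (w x :: nat)"
  shows "sum w (comp A) = sum w A"
proof -
  have "sum w (comp A) = sum (w \<circ> move A) A"
    unfolding comp_def by (rule sum.reindex[OF inj_move])
  also have "\<dots> = sum w A"
    by (rule sum.cong) (auto simp: move_def assms)
  finally show ?thesis .
qed

lemma card_comp: "card (comp A) = card A"
  unfolding comp_def by (rule card_image[OF inj_move])

text \<open>Provides the termination measure for repeated compression: every single move lowers
  \<open>h\<close>, and a compression that changes the family moves at least one element.\<close>

lemma comp_decreases:
  assumes "finite A" "\<And>x. x \<in> A \<Longrightarrow> x \<in> D \<Longrightarrow> h (\<phi> x) < (h x :: nat)"
  shows "sum h (comp A) \<le> sum h A" "comp A \<noteq> A \<Longrightarrow> sum h (comp A) < sum h A"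
proof -
  have eq: "sum h (comp A) = sum (h \<circ> move A) A"
    unfolding comp_def by (rule sum.reindex[OF inj_move])
  have le: "(h \<circ> move A) x \<le> h x" if "x \<in> A" for x
    using that by (auto simp: move_def intro: less_imp_le[OF assms(2)])
  show "sum h (comp A) \<le> sum h A"
    unfolding eq by (rule sum_mono[OF le])
  assume "comp A \<noteq> A"
  then obtain x where "x \<in> A" "move A x \<noteq> x"
    unfolding comp_def by (metis image_cong image_ident)
  then have "(h \<circ> move A) x < h x"
    using assms(2)[of x] by (auto simp: move_def split: if_splits)
  then show "sum h (comp A) < sum h A"
    unfolding eq using \<open>x \<in> A\<close> le assms(1) by (intro sum_strict_mono_ex1) auto
qed

text \<open>The case that matters is one moved element \<open>y\<close> against one unmoved
  \<open>x\<close>. If \<open>x\<close> lies in \<open>D\<close>, it stayed because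
  \<open>\<phi> x\<close> was occupied, so the pair \<open>\<phi> x\<close>, \<open>\<phi> y\<close>
  of old members has the same value of \<open>s\<close>; if \<open>x\<close> is in pushed position,
  \<open>gain\<close> applies.\<close>

lemma comp_cross:
  assumes cross: "\<And>x y. x \<in> A \<Longrightarrow> y \<in> B \<Longrightarrow> t \<le> s x y"
    and "x \<in> comp A" "y \<in> comp B"
  shows "t \<le> s x y"
proof -
  have one_moved: "t \<le> s x y"
    if cross: "\<And>x y. x \<in> A \<Longrightarrow> y \<in> B \<Longrightarrow> t \<le> s x y"
      and x: "x \<in> comp A" "x \<in> A" and y: "y \<in> comp B" "y \<notin> B" for A B x y
  proof -
    have y': "\<phi> y \<in> D" "\<phi> y \<in> B"
      using y comp_dom comp_img comp_fixed by metis+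
    consider "x \<in> D" | "\<phi> x \<in> D" | "\<phi> x = x"
      using unmoved by blast
    then show ?thesis
    proof cases
      case 1
      then have "\<phi> x \<in> A" using x comp_dom by blast
      then show ?thesis using cross y' invariant by metis
    next
      case 2
      then show ?thesis using gain[OF 2 y'(1)] cross[OF x(2) y'(2)] by linarith
    next
      case 3
      then show ?thesis using cross[OF x(2) y'(2)] invariant invol by metis
    qed
  qed
  consider "x \<in> A" "y \<in> B" | "x \<in> A" "y \<notin> B" | "x \<notin> A" "y \<in> B" | "x \<notin> A" "y \<notin> B"
    by blast
  then show ?thesis
  proof cases
    case 1 then show ?thesis using cross by blast
  next
    case 2 then show ?thesis using one_moved[OF cross] assms(2,3) by blast
  next
    case 3 then show ?thesis
      using one_moved[of B A y x] cross assms(2,3) commute by metis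
  next
    case 4
    then have "\<phi> x \<in> A" "\<phi> y \<in> B"
      using assms(2,3) comp_dom comp_img comp_fixed by metis+
    then show ?thesis using cross invariant by metis
  qed
qed

text \<open>
  The elements of \<open>P\<close> are those whose pair \<open>{g, \<phi> g}\<close> contributes exactly one member to
  each of the two families; common neighbours in \<open>P\<close> force all these choices to coincide.
\<close>

lemma comp_reverse:
  fixes X :: "'a set"
  defines "P \<equiv> {g \<in> D. g \<notin> X \<and> \<phi> g \<in> X}"
  assumes cross: "\<And>x y. x \<in> A \<Longrightarrow> y \<in> B \<Longrightarrow> t \<le> s x y"
    and A: "comp A = X" and B: "comp B = X"
    and nbr: "\<And>g g'. g \<in> P \<Longrightarrow> g' \<in> P \<Longrightarrow> \<exists>h\<in>P. s (\<phi> g) h < t \<and> s (\<phi> g') h < t"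
  shows "(A = X \<and> B = X) \<or> (A = \<phi> ` X \<and> B = \<phi> ` X)"
proof -
  have img: "x \<in> \<phi> ` Y \<longleftrightarrow> \<phi> x \<in> Y" for x Y
    by (metis image_iff invol)
  have pair: "x \<in> X \<longleftrightarrow> x \<in> C \<and> \<phi> x \<in> C" "\<phi> x \<in> X \<longleftrightarrow> x \<in> C \<or> \<phi> x \<in> C"
    if "comp C = X" "x \<in> D" for x C
    using comp_dom[of x C] comp_img[of "\<phi> x" C] that by (simp_all add: disj_commute)
  have one: "g \<in> C \<longleftrightarrow> \<phi> g \<notin> C" if "g \<in> P" "comp C = X" for g C
    using that pair[of C g] unfolding P_def by blast
  have keep: "C = X" if C: "comp C = X" "\<And>g. g \<in> P \<Longrightarrow> g \<notin> C" for C
  proof (rule set_eqI)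
    fix x
    have *: "y \<in> C \<longleftrightarrow> y \<in> X" "\<phi> y \<in> C \<longleftrightarrow> \<phi> y \<in> X" if "y \<in> D" for y
      using C(2)[of y] pair[OF C(1) that] that unfolding P_def by blast+
    show "x \<in> C \<longleftrightarrow> x \<in> X"
      using *(1)[of x] *(2)[of "\<phi> x"] comp_fixed[of x C] C(1) by (cases "x \<in> D"; cases "\<phi> x \<in> D") auto
  qed
  have swap: "C = \<phi> ` X" if C: "comp C = X" "\<And>g. g \<in> P \<Longrightarrow> g \<in> C" for C
  proof (rule set_eqI)
    fix x
    have *: "y \<in> C \<longleftrightarrow> \<phi> y \<in> X" "\<phi> y \<in> C \<longleftrightarrow> y \<in> X" if "y \<in> D" for y
      using C(2)[of y] one[OF _ C(1), of y] pair[OF C(1) that] that unfolding P_def by blast+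
    have "x \<in> C \<longleftrightarrow> \<phi> x \<in> X"
      using *(1)[of x] *(2)[of "\<phi> x"] comp_fixed[of x C] unmoved[of x] C(1)
      by (cases "x \<in> D"; cases "\<phi> x \<in> D") auto
    then show "x \<in> C \<longleftrightarrow> x \<in> \<phi> ` X" by (simp add: img)
  qed
  \<comment> \<open>For a neighbour \<open>h\<close> of \<open>g\<close>, the choice of
    \<open>A\<close> between \<open>g\<close> and \<open>\<phi> g\<close> forces the choice of
    \<open>B\<close> between \<open>h\<close> and \<open>\<phi> h\<close>, and conversely. Two
    elements of \<open>P\<close> with a common neighbour are therefore treated alike by
    \<open>A\<close>.\<close>
  have step: "h \<notin> B" if "g \<in> P" "h \<in> P" "\<phi> g \<in> A" "s (\<phi> g) h < t" for g h
    using cross that by fastforce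
  have step': "h \<in> B" if "g \<in> P" "h \<in> P" "g \<in> A" "s (\<phi> g) h < t" for g h
    using cross[of g "\<phi> h"] that one[OF that(2) B] invariant[of g "\<phi> h"] by auto
  show ?thesis
  proof (cases "\<exists>g\<in>P. g \<notin> A")
    case True
    then obtain g where g: "g \<in> P" "g \<notin> A" by blast
    have allA: "g' \<notin> A" if "g' \<in> P" for g'
      using nbr[OF g(1) that] step[OF g(1)] step'[OF that] one[OF g(1) A] g(2) by blast
    moreover have "h \<notin> B" if h: "h \<in> P" for h
    proof -
      obtain g where "g \<in> P" "s (\<phi> h) g < t" using nbr[OF h h] by blast
      moreover have "s (\<phi> g) h = s (\<phi> h) g"
        using invariant[of g "\<phi> h"] commute by simp
      ultimately show ?thesis using step[of g h] h allA one[OF _ A] by auto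
    qed
    ultimately show ?thesis using keep A B by blast
  next
    case False
    moreover have "h \<in> B" if h: "h \<in> P" for h
    proof -
      obtain g where "g \<in> P" "s (\<phi> h) g < t" using nbr[OF h h] by blast
      moreover have "s (\<phi> g) h = s (\<phi> h) g"
        using invariant[of g "\<phi> h"] commute by simp
      ultimately show ?thesis using step'[of g h] h False by auto
    qed
    ultimately show ?thesis using swap A B by blast
  qed
qed

end

section \<open>The two concrete compressions, on sequences and on sets\<close>

lemma compression_value:
  assumes "i \<in> {1..n::nat}" "v \<noteq> (1::nat)"
  shows "compression (\<lambda>a. a(i := Transposition.transpose 1 v (a i))) {a. a i = v}
    (\<lambda>a b. card {k \<in> {1..n}. a k = b k})"
proof
  fix x y :: "nat \<Rightarrow> nat"
  let ?f = "\<lambda>a. a(i := Transposition.transpose 1 v (a i))"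
  show "card {k \<in> {1..n}. ?f x k = ?f y k} = card {k \<in> {1..n}. x k = y k}"
    by (rule arg_cong[of _ _ card]) (auto simp: Transposition.transpose_def)
  show "card {k \<in> {1..n}. x k = y k} = card {k \<in> {1..n}. y k = x k}"
    by (rule arg_cong[of _ _ card]) auto
  \<comment> \<open>Both sequences have the value \<open>1\<close> at \<open>i\<close>, so changing
    \<open>y\<close> back to \<open>v\<close> there only destroys the agreement at
    \<open>i\<close>.\<close>
  assume "?f x \<in> {a. a i = v}" "?f y \<in> {a. a i = v}"
  then have "x i = 1" "y i = 1"
    by (auto simp: Transposition.transpose_def split: if_splits)
  then show "card {k \<in> {1..n}. x k = ?f y k} \<le> card {k \<in> {1..n}. x k = y k}"
    by (intro card_mono) auto
qed (use assms in \<open>auto simp: Transposition.transpose_def fun_eq_iff\<close>)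

lemma compression_shift:
  assumes "i \<noteq> (j::nat)"
  shows "compression (\<lambda>E. Transposition.transpose i j ` E) {E. j \<in> E \<and> i \<notin> E}
    (\<lambda>E F. card (E \<inter> F))"
proof
  let ?f = "\<lambda>E. Transposition.transpose i j ` E"
  have mem: "k \<in> ?f E \<longleftrightarrow> Transposition.transpose i j k \<in> E" for k E
    by (metis image_iff transpose_involutory)
  fix x y :: "nat set"
  show "?f (?f x) = x"
    by (simp add: image_comp)
  show "?f x \<notin> {E. j \<in> E \<and> i \<notin> E}" if "x \<in> {E. j \<in> E \<and> i \<notin> E}"
    using that by (simp add: mem)
  show "?f x = x" if "x \<notin> {E. j \<in> E \<and> i \<notin> E}" "?f x \<notin> {E. j \<in> E \<and> i \<notin> E}"
    using that by (auto simp: mem set_eq_iff) (auto simp: Transposition.transpose_def split: if_splits)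
  show "card (?f x \<inter> ?f y) = card (x \<inter> y)"
    by (simp add: image_Int[symmetric] card_image)
  show "card (x \<inter> y) = card (y \<inter> x)"
    by (simp add: Int_commute)
  \<comment> \<open>Both sets contain \<open>i\<close> but not \<open>j\<close>; trading
    \<open>i\<close> for \<open>j\<close> in \<open>y\<close> loses the common point
    \<open>i\<close> and gains none.\<close>
  assume "?f x \<in> {E. j \<in> E \<and> i \<notin> E}" "?f y \<in> {E. j \<in> E \<and> i \<notin> E}"
  then have "x \<inter> ?f y = x \<inter> y - {i}"
    by (auto simp: mem set_eq_iff) (auto simp: Transposition.transpose_def split: if_splits)
  then show "card (x \<inter> ?f y) \<le> card (x \<inter> y)"
    by (simp add: card_Diff1_le)
qed

section \<open>Weighted families of sets and the exchange argument\<close>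

locale sequence_space =
  fixes t m n :: nat
  assumes t: "7 \<le> t" and m: "t + 1 \<le> m" and n: "t \<le> n"
begin

text \<open>Up to the factor \<open>m ^ n\<close> this is the product measure on subsets of
  \<open>{1..n}\<close> in which each point is present with probability
  \<open>1 / m\<close>.\<close>

definition wt :: "nat set set \<Rightarrow> nat" where
  "wt A = (\<Sum>E\<in>A. (m - 1) ^ (n - card E))"

definition cross :: "nat set set \<Rightarrow> nat set set \<Rightarrow> bool" where
  "cross A B \<longleftrightarrow> A \<subseteq> Pow {1..n} \<and> B \<subseteq> Pow {1..n} \<and> (\<forall>E\<in>A. \<forall>F\<in>B. t \<le> card (E \<inter> F))"

definition optimal :: "nat set set \<Rightarrow> nat set set \<Rightarrow> bool" where
  "optimal A B \<longleftrightarrow> cross A B \<and> (\<forall>A' B'. cross A' B' \<longrightarrow> wt A' * wt B' \<le> wt A * wt B)"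

text \<open>The Frankl family with parameter \<open>r\<close>, placed on an arbitrary set
  \<open>T\<close> instead of \<open>{1..t + 2 * r}\<close>, since undoing a shift may move
  \<open>T\<close>.\<close>

definition slab :: "nat set \<Rightarrow> nat \<Rightarrow> nat set set" where
  "slab T r = {E. E \<subseteq> {1..n} \<and> t + r \<le> card (E \<inter> T)}"

definition shifted :: "nat set set \<Rightarrow> bool" where
  "shifted A \<longleftrightarrow> (\<forall>E\<in>A. \<forall>i j. 1 \<le> i \<longrightarrow> i < j \<longrightarrow> j \<in> E \<longrightarrow> i \<notin> E \<longrightarrow> insert i (E - {j}) \<in> A)"

text \<open>The members for which \<open>l\<close> is pivotal, sorted by their size in the first
  \<open>l\<close> coordinates because the exchange pairs size \<open>i\<close> with size
  \<open>l + t - i\<close>.\<close>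

definition layer :: "nat set set \<Rightarrow> nat \<Rightarrow> nat \<Rightarrow> nat set set" where
  "layer A l i = {E \<in> A. l \<in> E \<and> E - {l} \<notin> A \<and> card (E \<inter> {1..l}) = i}"

lemma finite_ground: "E \<subseteq> {1..n} \<Longrightarrow> finite E"
  by (rule finite_subset) auto

lemma card_ground: "E \<subseteq> {1..n} \<Longrightarrow> card E \<le> n"
  using card_mono[of "{1..n}" E] by simp

lemma finite_family: "A \<subseteq> Pow {1..n} \<Longrightarrow> finite A"
  by (rule finite_subset) auto

lemma crossD:
  assumes "cross A B"
  shows "A \<subseteq> Pow {1..n}" "B \<subseteq> Pow {1..n}" "finite A" "finite B"
    "\<And>E F. E \<in> A \<Longrightarrow> F \<in> B \<Longrightarrow> t \<le> card (E \<inter> F)"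
proof -
  show "A \<subseteq> Pow {1..n}" "B \<subseteq> Pow {1..n}"
    using assms unfolding cross_def by blast+
  then show "finite A" "finite B" by (simp_all add: finite_family)
  show "\<And>E F. E \<in> A \<Longrightarrow> F \<in> B \<Longrightarrow> t \<le> card (E \<inter> F)"
    using assms unfolding cross_def by blast
qed

lemma cross_sym:
  assumes "cross A B"
  shows "cross B A"
proof -
  have "t \<le> card (F \<inter> E)" if "F \<in> B" "E \<in> A" for E F
    using crossD(5)[OF assms that(2,1)] by (simp add: Int_commute)
  then show ?thesis using crossD(1,2)[OF assms] unfolding cross_def by blast
qed

lemma optimalD:
  assumes "optimal A B"
  shows "cross A B" "\<And>A' B'. cross A' B' \<Longrightarrow> wt A' * wt B' \<le> wt A * wt B"
proof -
  show "cross A B" using assms unfolding optimal_def by (rule conjunct1)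
  show "wt A' * wt B' \<le> wt A * wt B" if "cross A' B'" for A' B'
    using assms that unfolding optimal_def by blast
qed

lemma optimal_sym:
  assumes "optimal A B"
  shows "optimal B A"
proof -
  have "wt A' * wt B' \<le> wt B * wt A" if "cross A' B'" for A' B'
    using optimalD(2)[OF assms cross_sym[OF that]] by (simp add: mult.commute)
  then show ?thesis using cross_sym[OF optimalD(1)[OF assms]] unfolding optimal_def by blast
qed

section \<open>Weights of families described by few coordinates\<close>

lemma wt_mono: "B \<subseteq> Pow {1..n} \<Longrightarrow> A \<subseteq> B \<Longrightarrow> wt A \<le> wt B"
  unfolding wt_def using finite_family by (intro sum_mono2) auto

lemma wt_strict_mono:
  assumes B: "B \<subseteq> Pow {1..n}" and "A \<subset> B"
  shows "wt A < wt B"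
proof -
  obtain E where "E \<in> B - A" using assms(2) by blast
  then show ?thesis
    unfolding wt_def using assms finite_family[OF B] m t
    by (intro sum_strict_mono2[where b = E]) auto
qed

lemma wt_UN_le:
  assumes "finite I" "\<And>i. i \<in> I \<Longrightarrow> S i \<subseteq> Pow {1..n}"
  shows "wt (\<Union>i\<in>I. S i) \<le> (\<Sum>i\<in>I. wt (S i))"
  using assms
proof (induction I rule: finite_induct)
  case empty
  then show ?case by (simp add: wt_def)
next
  case (insert i I)
  have fin: "finite (S i)" "finite (\<Union>i\<in>I. S i)"
    using insert.hyps finite_family[OF insert.prems] by simp_all
  have "wt (S i \<union> (\<Union>i\<in>I. S i)) \<le> wt (S i) + wt (\<Union>i\<in>I. S i)"
    unfolding wt_def
    by (subst sum.union_inter[symmetric]) (use fin in auto)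
  with insert show ?case by auto
qed

text \<open>A coordinate outside \<open>V\<close> is free and contributes the factor
  \<open>1 + (m - 1) = m\<close>; expanding this product over subsets with \<open>prod_add\<close>
  gives the sum of weights.\<close>

lemma wt_trace:
  assumes "S \<subseteq> V" "V \<subseteq> {1..n}"
  shows "wt {E. E \<subseteq> {1..n} \<and> E \<inter> V = S} = (m - 1) ^ (card V - card S) * m ^ (n - card V)"
proof -
  let ?R = "{1..n} - V"
  have fin: "finite V" "finite S" "finite ?R"
    using assms finite_ground finite_subset by blast+
  have R: "card ?R = n - card V" and V: "card V \<le> n"
    using assms fin card_Diff_subset[of V "{1..n}"] card_ground by auto
  have SV: "card S \<le> card V" using assms fin card_mono by blast
  have eq: "{E. E \<subseteq> {1..n} \<and> E \<inter> V = S} = (\<lambda>G. S \<union> G) ` Pow ?R"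
  proof (intro equalityI subsetI)
    fix E assume E: "E \<in> {E. E \<subseteq> {1..n} \<and> E \<inter> V = S}"
    then have "E = S \<union> (E - V)" "E - V \<in> Pow ?R" by auto
    then show "E \<in> (\<lambda>G. S \<union> G) ` Pow ?R" by (rule image_eqI)
  qed (use assms in auto)
  have inj: "inj_on (\<lambda>G. S \<union> G) (Pow ?R)"
    using assms by (intro inj_onI) blast
  have "wt {E. E \<subseteq> {1..n} \<and> E \<inter> V = S} = (\<Sum>G\<in>Pow ?R. (m - 1) ^ (n - card (S \<union> G)))"
    unfolding wt_def eq by (subst sum.reindex[OF inj]) simp
  also have "\<dots> = (\<Sum>G\<in>Pow ?R. (m - 1) ^ (card V - card S) * (m - 1) ^ card (?R - G))"
  proof (rule sum.cong)
    fix G assume G: "G \<in> Pow ?R"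
    then have "card (S \<union> G) = card S + card G"
      using fin assms by (intro card_Un_disjoint) (auto intro: finite_subset)
    moreover have "card (?R - G) = card ?R - card G" "card G \<le> card ?R"
      using G fin by (auto intro!: card_Diff_subset card_mono intro: finite_subset)
    ultimately have "n - card (S \<union> G) = (card V - card S) + card (?R - G)"
      using R V SV by linarith
    then show "(m - 1) ^ (n - card (S \<union> G)) = (m - 1) ^ (card V - card S) * (m - 1) ^ card (?R - G)"
      by (simp add: power_add)
  qed simp
  also have "\<dots> = (m - 1) ^ (card V - card S) * (\<Prod>x\<in>?R. 1 + (m - 1))"
    unfolding prod_add[OF fin(3)] by (simp add: sum_distrib_left)
  also have "\<dots> = (m - 1) ^ (card V - card S) * m ^ (n - card V)"
    using m t R by simp
  finally show ?thesis .
qed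

lemma wt_superset:
  assumes "S \<subseteq> {1..n}"
  shows "wt {E. E \<subseteq> {1..n} \<and> S \<subseteq> E} = m ^ (n - card S)"
proof -
  have "{E. E \<subseteq> {1..n} \<and> S \<subseteq> E} = {E. E \<subseteq> {1..n} \<and> E \<inter> S = S}" by blast
  then show ?thesis using wt_trace[of S S] assms by simp
qed

text \<open>Such a set contains \<open>V\<close> or misses exactly one of its \<open>Suc k\<close>
  points, which splits the family into disjoint classes with a fixed trace on
  \<open>V\<close>.\<close>

lemma wt_miss_one:
  assumes "V \<subseteq> {1..n}" "card V = Suc k"
  shows "wt {E. E \<subseteq> {1..n} \<and> k \<le> card (E \<inter> V)} = m ^ (n - Suc k) * (1 + Suc k * (m - 1))"
proof -
  have fin: "finite V" using assms finite_ground by blast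
  define Z where "Z S = {E. E \<subseteq> {1..n} \<and> E \<inter> V = S}" for S
  have Z: "Z S \<subseteq> Pow {1..n}" "finite (Z S)" for S
    using finite_family[of "Z S"] by (auto simp: Z_def)
  have "{E. E \<subseteq> {1..n} \<and> k \<le> card (E \<inter> V)} = Z V \<union> (\<Union>e\<in>V. Z (V - {e}))"
  proof (intro equalityI subsetI)
    fix E assume E: "E \<in> {E. E \<subseteq> {1..n} \<and> k \<le> card (E \<inter> V)}"
    have "card (V - E) = card V - card (E \<inter> V)"
      using fin card_Diff_subset_Int[of V E] by (simp add: Int_commute)
    then have "card (V - E) \<le> 1" using E assms by auto
    then obtain e where e: "V - E \<subseteq> {e}"
      using fin by (metis card_le_Suc0_iff_eq One_nat_def finite_Diff insertCI subsetI)
    show "E \<in> Z V \<union> (\<Union>e\<in>V. Z (V - {e}))"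
    proof (cases "e \<in> V - E")
      case True
      then have "E \<inter> V = V - {e}" using e by auto
      then show ?thesis using E True by (auto simp: Z_def)
    next
      case False
      then have "E \<inter> V = V" using e by auto
      then show ?thesis using E by (auto simp: Z_def)
    qed
  next
    fix E assume "E \<in> Z V \<union> (\<Union>e\<in>V. Z (V - {e}))"
    then show "E \<in> {E. E \<subseteq> {1..n} \<and> k \<le> card (E \<inter> V)}"
      using assms fin by (auto simp: Z_def)
  qed
  also have "wt \<dots> = wt (Z V) + wt (\<Union>e\<in>V. Z (V - {e}))"
    unfolding wt_def using Z fin by (intro sum.union_disjoint) (auto simp: Z_def)
  also have "wt (\<Union>e\<in>V. Z (V - {e})) = (\<Sum>e\<in>V. wt (Z (V - {e})))"
    unfolding wt_def using Z fin by (intro sum.UNION_disjoint) (auto simp: Z_def)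
  also have "\<dots> = (\<Sum>e\<in>V. (m - 1) * m ^ (n - Suc k))"
  proof (rule sum.cong)
    fix e assume "e \<in> V"
    then show "wt (Z (V - {e})) = (m - 1) * m ^ (n - Suc k)"
      using wt_trace[of "V - {e}" V] assms fin unfolding Z_def by simp
  qed simp
  also have "wt (Z V) = m ^ (n - Suc k)"
    unfolding Z_def using wt_trace[of V V] assms by simp
  finally show ?thesis using assms(2) by (simp add: algebra_simps)
qed

section \<open>Slabs as competitors and first properties of optimal pairs\<close>

lemma cross_slab:
  assumes "T \<subseteq> {1..n}" "card T \<le> t + 2 * r"
  shows "cross (slab T r) (slab T r)"
proof -
  have fin: "finite T" using assms finite_ground by blast
  have "t \<le> card (E \<inter> F)" if "t + r \<le> card (E \<inter> T)" "t + r \<le> card (F \<inter> T)" "E \<subseteq> {1..n}" for E F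
  proof -
    have "card (E \<inter> T) + card (F \<inter> T) = card ((E \<inter> T) \<union> (F \<inter> T)) + card ((E \<inter> T) \<inter> (F \<inter> T))"
      using fin by (intro card_Un_Int) auto
    moreover have "card ((E \<inter> T) \<union> (F \<inter> T)) \<le> card T"
      using fin by (intro card_mono) auto
    moreover have "card ((E \<inter> T) \<inter> (F \<inter> T)) \<le> card (E \<inter> F)"
      using finite_ground[OF that(3)] by (intro card_mono) auto
    ultimately show ?thesis using that assms(2) by linarith
  qed
  then show ?thesis unfolding cross_def slab_def by auto
qed

lemma slab_0:
  assumes "T \<subseteq> {1..n}" "card T = t"
  shows "slab T 0 = {E. E \<subseteq> {1..n} \<and> T \<subseteq> E}"
proof -
  have "t \<le> card (E \<inter> T) \<longleftrightarrow> T \<subseteq> E" for E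
    using assms finite_ground[of T] card_seteq[of T "E \<inter> T"] by (auto simp: Int_absorb1)
  then show ?thesis unfolding slab_def by auto
qed

lemma wt_slab_0: "T \<subseteq> {1..n} \<Longrightarrow> card T = t \<Longrightarrow> wt (slab T 0) = m ^ (n - t)"
  using wt_superset[of T] slab_0[of T] by simp

lemma wt_slab_1:
  assumes "T \<subseteq> {1..n}" "card T = t + 2"
  shows "wt (slab T 1) = m ^ (n - (t + 2)) * (1 + (t + 2) * (m - 1))"
proof -
  have "wt (slab T 1) = m ^ (n - Suc (t + 1)) * (1 + Suc (t + 1) * (m - 1))"
    unfolding slab_def by (rule wt_miss_one) (use assms in auto)
  then show ?thesis by simp
qed

text \<open>Comparison with the pair in which both families consist of all sets containing
  \<open>{1..t}\<close>. Positivity of the weights is what later permits strict comparison of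
  products.\<close>

lemma optimal_wt:
  assumes "optimal A B"
  shows "(m ^ (n - t))\<^sup>2 \<le> wt A * wt B" "0 < wt A" "0 < wt B"
proof -
  have T: "{1..t} \<subseteq> {1..n}" "card {1..t} = t" using n by auto
  show le: "(m ^ (n - t))\<^sup>2 \<le> wt A * wt B"
    using optimalD(2)[OF assms cross_slab[of "{1..t}" 0]] T wt_slab_0[OF T]
    by (simp add: power2_eq_square)
  moreover have "0 < (m ^ (n - t))\<^sup>2" using m by simp
  ultimately show "0 < wt A" "0 < wt B" by (auto intro: gr0I)
qed

text \<open>Since both weights are positive, enlarging either family would strictly increase the
  product. Hence it suffices later to show that an optimal pair is contained in a slab.\<close>

lemma optimal_extend:
  assumes opt: "optimal A B" and sub: "A \<subseteq> A'" "B \<subseteq> B'" and "cross A' B'"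
  shows "A = A'" "B = B'"
proof -
  have P: "A' \<subseteq> Pow {1..n}" "B' \<subseteq> Pow {1..n}" using crossD[OF assms(4)] by auto
  have le: "wt A' * wt B' \<le> wt A * wt B" using optimalD[OF opt] assms by blast
  have mono: "wt A \<le> wt A'" "wt B \<le> wt B'" using wt_mono P sub by blast+
  show "A = A'"
  proof (rule ccontr)
    assume "A \<noteq> A'"
    then have "wt A < wt A'" using wt_strict_mono P sub by blast
    then have "wt A * wt B < wt A' * wt B'"
      using mono optimal_wt[OF opt] by (intro mult_less_le_imp_less) auto
    then show False using le by simp
  qed
  show "B = B'"
  proof (rule ccontr)
    assume "B \<noteq> B'"
    then have "wt B < wt B'" using wt_strict_mono P sub by blast
    then have "wt A * wt B < wt A' * wt B'"
      using mono optimal_wt[OF opt] by (intro mult_le_less_imp_less) auto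
    then show False using le by simp
  qed
qed

section \<open>The exchange between pivotal layers\<close>

lemma card_exchange:
  assumes "finite X" "l \<in> X" "k \<notin> X"
  shows "card (insert k (X - {l})) = card X"
proof -
  have "card (insert k (X - {l})) = Suc (card (X - {l}))"
    using assms by (intro card_insert_disjoint) auto
  also have "\<dots> = card X" using assms by (intro card_Suc_Diff1)
  finally show ?thesis .
qed

lemma layer_subset: "layer A l i \<subseteq> A"
  unfolding layer_def by auto

text \<open>If a kept \<open>E\<close> met a lowered \<open>F\<close> in fewer than \<open>t\<close>
  points, then \<open>l\<close> would be pivotal for \<open>E\<close>, and the traces on
  \<open>{1..l}\<close> would cover \<open>{1..l}\<close> and share exactly \<open>t\<close> points.
  Their sizes would add up to \<open>l + t = i + j\<close>, so \<open>E\<close> would belong to the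
  removed layer.\<close>

lemma cross_push:
  assumes cross: "cross A B" and sh: "shifted A"
    and dep: "\<And>E. E \<in> A \<Longrightarrow> E \<inter> {1..l} \<in> A" "\<And>F. F \<in> B \<Longrightarrow> F \<inter> {1..l} \<in> B"
    and ij: "i + j = l + t"
  shows "cross (A - layer A l i) (B \<union> (\<lambda>F. F - {l}) ` layer B l j)"
proof -
  note C = crossD[OF cross]
  have "t \<le> card (E \<inter> (F - {l}))" if E: "E \<in> A" "E \<notin> layer A l i" and F: "F \<in> layer B l j" for E F
  proof (rule ccontr)
    assume lt: "\<not> t \<le> card (E \<inter> (F - {l}))"
    have FB: "F \<in> B" "l \<in> F" "card (F \<inter> {1..l}) = j" using F by (auto simp: layer_def)
    have l: "1 \<le> l" using subsetD[OF C(2) FB(1)] FB(2) by auto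
    have "l \<in> E"
    proof (rule ccontr)
      assume "l \<notin> E"
      then have "E \<inter> (F - {l}) = E \<inter> F" by auto
      then show False using lt C(5)[OF E(1) FB(1)] by simp
    qed
    moreover have "E - {l} \<notin> A"
    proof
      assume "E - {l} \<in> A"
      moreover have "E \<inter> (F - {l}) = (E - {l}) \<inter> F" by auto
      ultimately show False using lt C(5)[of "E - {l}", OF _ FB(1)] by simp
    qed
    ultimately have Ei: "card (E \<inter> {1..l}) \<noteq> i" using E by (auto simp: layer_def)
    define E0 F0 where "E0 = E \<inter> {1..l}" and "F0 = F \<inter> {1..l}"
    have mem: "E0 \<in> A" "F0 \<in> B" using dep E(1) FB(1) by (auto simp: E0_def F0_def)
    have lE: "l \<in> E0" "l \<in> F0" using \<open>l \<in> E\<close> FB(2) l by (auto simp: E0_def F0_def)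
    have "card (E0 \<inter> F0 - {l}) \<le> card (E \<inter> (F - {l}))"
      using C(1) E(1) finite_ground by (intro card_mono) (auto simp: E0_def F0_def)
    then have less: "card (E0 \<inter> F0 - {l}) < t" using lt by simp
    have fin: "finite E0" "finite F0" by (auto simp: E0_def F0_def)
    have card0: "card (E0 \<inter> F0) = t"
      using less C(5)[OF mem] lE fin by (simp add: card_Diff_singleton)
    \<comment> \<open>A point \<open>k < l\<close> in neither trace would allow the shift of
      \<open>E0\<close> from \<open>l\<close> to \<open>k\<close>, which loses the common point
      \<open>l\<close> and leaves only \<open>t - 1\<close> common points.\<close>
    have "E0 \<union> F0 = {1..l}"
    proof (rule ccontr)
      assume "E0 \<union> F0 \<noteq> {1..l}"
      moreover have "E0 \<union> F0 \<subseteq> {1..l}" unfolding E0_def F0_def by blast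
      ultimately obtain k where k: "k \<in> {1..l}" "k \<notin> E0" "k \<notin> F0" by blast
      then have "k < l" using lE by (cases "k = l") auto
      then have "insert k (E0 - {l}) \<in> A"
        using sh mem(1) lE k unfolding shifted_def by auto
      moreover have "insert k (E0 - {l}) \<inter> F0 = E0 \<inter> F0 - {l}" using k by auto
      ultimately show False using C(5)[of "insert k (E0 - {l})", OF _ mem(2)] less by simp
    qed
    then have "card E0 + card F0 = l + t"
      using card_Un_Int[OF fin] card0 by simp
    then show False using Ei FB(3) ij by (simp add: E0_def F0_def)
  qed
  moreover have "(\<lambda>F. F - {l}) ` layer B l j \<subseteq> Pow {1..n}"
    using C(2) by (auto simp: layer_def)
  ultimately show ?thesis using cross unfolding cross_def by auto
qed

lemma wt_lowered:
  assumes "A \<subseteq> Pow {1..n}"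
  shows "wt ((\<lambda>E. E - {l}) ` layer A l i) = (m - 1) * wt (layer A l i)"
proof -
  have inj: "inj_on (\<lambda>E. E - {l}) (layer A l i)"
    by (rule inj_onI) (auto simp: layer_def)
  have "wt ((\<lambda>E. E - {l}) ` layer A l i) = (\<Sum>E\<in>layer A l i. (m - 1) ^ (n - card (E - {l})))"
    unfolding wt_def by (simp add: sum.reindex[OF inj])
  also have "\<dots> = (\<Sum>E\<in>layer A l i. (m - 1) * (m - 1) ^ (n - card E))"
  proof (rule sum.cong)
    fix E assume "E \<in> layer A l i"
    then have E: "l \<in> E" "E \<subseteq> {1..n}" using assms by (auto simp: layer_def)
    then have "card E \<noteq> 0" "card E \<le> n" using finite_ground[of E] card_ground by auto
    then have "n - card (E - {l}) = Suc (n - card E)"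
      using E finite_ground[of E] by (simp add: card_Diff_singleton)
    then show "(m - 1) ^ (n - card (E - {l})) = (m - 1) * (m - 1) ^ (n - card E)" by simp
  qed simp
  finally show ?thesis unfolding wt_def by (simp add: sum_distrib_left)
qed

text \<open>Because \<open>l\<close> is pivotal, the lowered sets are new to \<open>B\<close>, so
  their weight is added in full; each is \<open>m - 1\<close> times as heavy as the set it came
  from.\<close>

lemma wt_push:
  assumes opt: "optimal A B" and sh: "shifted A"
    and dep: "\<And>E. E \<in> A \<Longrightarrow> E \<inter> {1..l} \<in> A" "\<And>F. F \<in> B \<Longrightarrow> F \<inter> {1..l} \<in> B"
    and ij: "i + j = l + t"
  shows "(wt A - wt (layer A l i)) * (wt B + (m - 1) * wt (layer B l j)) \<le> wt A * wt B"
proof -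
  note C = crossD[OF optimalD(1)[OF opt]]
  have "wt (A - layer A l i) = wt A - wt (layer A l i)"
    unfolding wt_def by (rule sum_diff_nat[OF finite_subset[OF layer_subset C(3)] layer_subset])
  moreover have "wt (B \<union> (\<lambda>F. F - {l}) ` layer B l j) = wt B + (m - 1) * wt (layer B l j)"
  proof -
    have "finite (layer B l j)" by (rule finite_subset[OF layer_subset C(4)])
    then have "wt (B \<union> (\<lambda>F. F - {l}) ` layer B l j) = wt B + wt ((\<lambda>F. F - {l}) ` layer B l j)"
      unfolding wt_def using C(4) by (intro sum.union_disjoint) (auto simp: layer_def)
    then show ?thesis using wt_lowered[OF C(2)] by simp
  qed
  ultimately show ?thesis
    using optimalD(2)[OF opt cross_push[OF optimalD(1)[OF opt] sh dep ij]] by simp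
qed

text \<open>Double counting of pairs \<open>(E, k)\<close> with \<open>E\<close> in the layer and
  \<open>k\<close> one of the \<open>l - i\<close> points missing from it. Replacing
  \<open>l\<close> by \<open>k\<close> gives a member without \<open>l\<close>, hence outside the
  layer, of the same weight, and each such member arises for at most \<open>i\<close> choices of
  \<open>k\<close>.\<close>

lemma shift_count:
  assumes A: "A \<subseteq> Pow {1..n}" and sh: "shifted A"
  shows "(l - i) * wt (layer A l i) \<le> i * (wt A - wt (layer A l i))"
proof -
  let ?L = "layer A l i"
  let ?w = "\<lambda>E. (m - 1) ^ (n - card E)"
  let ?M = "{E \<in> A. l \<notin> E \<and> card (E \<inter> {1..l}) = i}"
  let ?f = "\<lambda>(E, k). (insert k (E - {l}), k)"
  define S where "S = Sigma ?L (\<lambda>E. {1..l} - E)"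
  define S' where "S' = Sigma ?M (\<lambda>E. E \<inter> {1..l})"
  have fin: "finite A" "finite ?L" "finite ?M"
    using finite_family[OF A] finite_subset[OF layer_subset] by auto
  have card_L: "card ({1..l} - E) = l - i" if "E \<in> ?L" for E
    using that card_Diff_subset_Int[of "{1..l}" E] by (simp add: layer_def Int_commute)
  have inS: "finite E" "l \<in> E" "E \<in> A" "k \<in> {1..l}" "k \<notin> E" "k < l" "card (E \<inter> {1..l}) = i"
    if "(E, k) \<in> S" for E k
    using that A finite_ground[of E] by (auto simp: S_def layer_def intro: le_neq_implies_less)
  \<comment> \<open>Recording \<open>k\<close> in the image makes the map reversible: remove
    \<open>k\<close> and put \<open>l\<close> back.\<close>
  have inj: "inj_on ?f S"
  proof (rule inj_onI)
    fix p p' assume p: "p \<in> S" "p' \<in> S" "?f p = ?f p'"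
    obtain E k E' k' where pp: "p = (E, k)" "p' = (E', k')" by (cases p, cases p')
    with p have *: "(E, k) \<in> S" "(E', k') \<in> S" "insert k (E - {l}) = insert k' (E' - {l})" "k = k'"
      by auto
    have "E - {l} = E' - {l}"
      using * inS(5)[OF *(1)] inS(5)[OF *(2)] by auto
    then show "p = p'" unfolding pp using * inS(2)[OF *(1)] inS(2)[OF *(2)] by auto
  qed
  have img: "?f ` S \<subseteq> S'"
  proof clarify
    fix E k assume Ek: "(E, k) \<in> S"
    note * = inS[OF Ek]
    have "insert k (E - {l}) \<in> A" using sh * unfolding shifted_def by auto
    moreover have "card (insert k (E - {l}) \<inter> {1..l}) = i"
    proof -
      have "insert k (E - {l}) \<inter> {1..l} = insert k (E \<inter> {1..l} - {l})" using * by auto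
      moreover have "card (insert k (E \<inter> {1..l} - {l})) = card (E \<inter> {1..l})"
        using * by (intro card_exchange) auto
      ultimately show ?thesis using * by simp
    qed
    ultimately show "(insert k (E - {l}), k) \<in> S'" using * by (auto simp: S'_def)
  qed
  have "(l - i) * wt ?L = (\<Sum>E\<in>?L. \<Sum>k\<in>{1..l} - E. ?w E)"
    unfolding wt_def using card_L by (simp add: sum_distrib_left)
  also have "\<dots> = (\<Sum>p\<in>S. ?w (fst p))"
    unfolding S_def using fin by (subst sum.Sigma) (auto simp: case_prod_beta)
  also have "\<dots> = (\<Sum>p\<in>S. ?w (fst (?f p)))"
  proof (rule sum.cong)
    fix p assume "p \<in> S"
    then obtain E k where "p = (E, k)" "(E, k) \<in> S" by (cases p) simp
    then show "?w (fst p) = ?w (fst (?f p))"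
      using card_exchange[OF inS(1,2,5)] by simp
  qed simp
  also have "\<dots> = (\<Sum>p\<in>?f ` S. ?w (fst p))"
    by (subst sum.reindex[OF inj]) simp
  also have "\<dots> \<le> (\<Sum>p\<in>S'. ?w (fst p))"
    using img fin by (intro sum_mono2) (auto simp: S'_def)
  also have "\<dots> = (\<Sum>E\<in>?M. \<Sum>k\<in>E \<inter> {1..l}. ?w E)"
    unfolding S'_def using fin by (subst sum.Sigma) (auto simp: case_prod_beta)
  also have "\<dots> = i * wt ?M"
    unfolding wt_def by (simp add: sum_distrib_left)
  also have "\<dots> \<le> i * wt (A - ?L)"
    using A by (intro mult_le_mono2 wt_mono) (auto simp: layer_def)
  also have "wt (A - ?L) = wt A - wt ?L"
    unfolding wt_def by (rule sum_diff_nat[OF fin(2) layer_subset])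
  finally show ?thesis .
qed

end

text \<open>Here \<open>X\<close>, \<open>Y\<close> are the two total weights and \<open>a\<close>,
  \<open>b\<close> the weights of the paired layers. The second conclusion says that at most the
  fraction \<open>1 / (m - 1)\<close> of \<open>X\<close> lies outside the layer.\<close>

lemma push_arith:
  fixes X Y a b m :: nat
  assumes "a \<le> X" "b \<le> Y" "0 < a" "0 < Y" "2 \<le> m"
    and 1: "(X - a) * (Y + (m - 1) * b) \<le> X * Y"
    and 2: "(Y - b) * (X + (m - 1) * a) \<le> Y * X"
  shows "0 < b" "(m - 2) * (X - a) \<le> a"
proof -
  define x y c d q where "x = int X" "y = int Y" "c = int a" "d = int b" "q = int m - 1"
  note defs = this
  have q: "1 \<le> q" "0 < c" "0 < y" "0 \<le> d" using assms by (auto simp: defs)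
  have "int ((X - a) * (Y + (m - 1) * b)) \<le> int (X * Y)" using 1 by linarith
  then have i1: "(x - c) * (y + q * d) \<le> x * y" using assms by (simp add: defs of_nat_diff)
  have "int ((Y - b) * (X + (m - 1) * a)) \<le> int (Y * X)" using 2 by linarith
  then have i2: "(y - d) * (x + q * c) \<le> y * x" using assms by (simp add: defs of_nat_diff)
  have "d \<noteq> 0"
  proof
    assume "d = 0"
    then have "y * (q * c) \<le> 0" using i2 by (simp add: algebra_simps)
    moreover have "0 < y * (q * c)" using q by simp
    ultimately show False by simp
  qed
  then have d: "0 < d" using q by simp
  then show "0 < b" by (simp add: defs)
  \<comment> \<open>\<open>q\<close> times the first inequality plus the second one eliminates \<open>y\<close>.\<close>
  have j1: "q * (q * d * x - c * y - q * c * d) \<le> 0"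
    using i1 q by (intro mult_nonneg_nonpos) (auto simp: algebra_simps)
  have j2: "q * c * y - d * x - q * c * d \<le> 0" using i2 by (simp add: algebra_simps)
  have "(d * (q + 1)) * ((q - 1) * x - q * c) \<le> 0"
    using j1 j2 by (simp add: algebra_simps)
  moreover have "0 < d * (q + 1)" using d q by simp
  ultimately have "(q - 1) * x - q * c \<le> 0" by (metis mult_pos_pos not_le)
  then have "(q - 1) * (x - c) \<le> c" by (simp add: algebra_simps)
  then have "int ((m - 2) * (X - a)) \<le> int a" using assms by (simp add: defs of_nat_diff)
  then show "(m - 2) * (X - a) \<le> a" by linarith
qed

context sequence_space begin

section \<open>Reduction of shifted optimal pairs to the first \<open>t + 2\<close>
  coordinates\<close>

lemma level_le:
  assumes opt: "optimal A B" and sh: "shifted A" "shifted B"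
    and dep: "\<And>E. E \<in> A \<Longrightarrow> E \<inter> {1..l} \<in> A" "\<And>F. F \<in> B \<Longrightarrow> F \<inter> {1..l} \<in> B"
    and E: "E \<in> A" "l \<in> E" "E - {l} \<notin> A"
  shows "l \<le> t + 2"
proof -
  note C = crossD[OF optimalD(1)[OF opt]]
  define i where "i = card (E \<inter> {1..l})"
  define j where "j = l + t - i"
  define a b where "a = wt (layer A l i)" and "b = wt (layer B l j)"
  have i_le: "card (F \<inter> {1..l}) \<le> l" for F using card_mono[of "{1..l}" "F \<inter> {1..l}"] by simp
  then have "i \<le> l" unfolding i_def .
  then have ij: "i + j = l + t" "j + i = l + t" unfolding j_def by simp_all
  have pos: "0 < wt L" if "L \<subseteq> Pow {1..n}" "F \<in> L" for L F
  proof -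
    have "{} \<subset> L" using that(2) by blast
    then show ?thesis using wt_strict_mono[OF that(1)] gr_implies_not0 by blast
  qed
  have "E \<in> layer A l i" using E by (simp add: layer_def i_def)
  then have a: "0 < a"
    unfolding a_def using subset_trans[OF layer_subset C(1)] by (rule pos[rotated])
  have le: "a \<le> wt A" "b \<le> wt B"
    unfolding a_def b_def by (rule wt_mono[OF C(1) layer_subset], rule wt_mono[OF C(2) layer_subset])
  have m2: "2 \<le> m" using m t by simp
  note push = wt_push[OF opt sh(1) dep ij(1)] wt_push[OF optimal_sym[OF opt] sh(2) dep(2,1) ij(2)]
  note ar = push_arith[OF le a optimal_wt(3)[OF opt] m2 push[folded a_def b_def]]
  \<comment> \<open>If the opposite layer were empty, lowering the layer of \<open>A\<close> would
    cost nothing in \<open>B\<close>. Its positivity makes the mirrored bound available as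
    well.\<close>
  have b: "0 < b" by (rule ar(1))
  note ar' = push_arith(2)[OF le(2,1) b optimal_wt(2)[OF opt] m2 push(2,1)[folded a_def b_def]]
  have "layer B l j \<noteq> {}" using b unfolding b_def wt_def by auto
  then have jl: "j \<le> l" using i_le by (auto simp: layer_def)
  \<comment> \<open>Combines the shift count with the concentration of weight; \<open>c\<close> is
    the weight of the layer, \<open>d\<close> the weight outside it, and \<open>c\<close>
    cancels.\<close>
  have bound: "(m - 2) * (l - k) \<le> k"
    if "0 < c" "(l - k) * c \<le> k * d" "(m - 2) * d \<le> c" for k c d :: nat
  proof -
    have "(m - 2) * (l - k) * c \<le> (m - 2) * (k * d)"
      using mult_le_mono2[OF that(2), of "m - 2"] by (simp add: mult.assoc)
    also have "\<dots> \<le> k * c"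
      using mult_le_mono2[OF that(3), of k] by (simp add: ac_simps)
    finally show ?thesis using that(1) by simp
  qed
  have "(m - 2) * (l - i) \<le> i"
    using bound[OF a shift_count[OF C(1) sh(1), of l i, folded a_def] ar(2)] .
  moreover have "(m - 2) * (l - j) \<le> j"
    using bound[OF b shift_count[OF C(2) sh(2), of l j, folded b_def] ar'] .
  ultimately have "(m - 2) * ((l - i) + (l - j)) \<le> i + j" by (simp add: distrib_left)
  moreover have "(l - i) + (l - j) = l - t" using ij jl i_le[of E] unfolding i_def[symmetric] by linarith
  ultimately have le2: "(m - 2) * (l - t) \<le> l + t" using ij by simp
  show ?thesis
  proof (rule ccontr)
    assume "\<not> l \<le> t + 2"
    then obtain s where s: "l = t + s" "3 \<le> s"
      using that[of "l - t"] by simp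
    \<comment> \<open>With \<open>m - 2 \<ge> t - 1\<close> the inequality becomes
      \<open>(t - 2) * s \<le> 2 * t\<close>; for \<open>s \<ge> 3\<close> it would give
      \<open>t \<le> 6\<close>, against the lower bound \<open>7\<close> of the locale.\<close>
    have "(t - 1) * s \<le> (m - 2) * s" using m by (intro mult_le_mono1) auto
    also have "\<dots> \<le> 2 * t + s" using le2 s by simp
    finally have "(t - 1) * s \<le> 2 * t + s" .
    moreover have "(t - 1) * s = (t - 2) * s + s"
    proof -
      have "t - 1 = (t - 2) + 1" using t by simp
      then show ?thesis by (simp only: distrib_right mult_1)
    qed
    moreover have "(t - 2) * 3 \<le> (t - 2) * s" using s by (intro mult_le_mono2)
    ultimately show False using t by linarith
  qed
qed

text \<open>Downward induction, starting at \<open>max n l\<close> where truncation changes nothing.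
  By \<open>level_le\<close> the coordinate \<open>Suc k\<close> beyond \<open>t + 2\<close> is
  never pivotal, so it may be deleted from every member.\<close>

lemma dependence:
  assumes opt: "optimal A B" and sh: "shifted A" "shifted B" and "t + 2 \<le> l"
  shows "(\<forall>E\<in>A. E \<inter> {1..l} \<in> A) \<and> (\<forall>F\<in>B. F \<inter> {1..l} \<in> B)"
proof -
  note C = crossD[OF optimalD(1)[OF opt]]
  let ?Q = "\<lambda>l. (\<forall>E\<in>A. E \<inter> {1..l} \<in> A) \<and> (\<forall>F\<in>B. F \<inter> {1..l} \<in> B)"
  have trivial: "?Q l" if "n \<le> l" for l
  proof -
    have "E \<inter> {1..l} = E" if "E \<subseteq> {1..n}" for E using that \<open>n \<le> l\<close> by fastforce
    then show ?thesis using C(1,2) by (metis Pow_iff subsetD)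
  qed
  have "?Q l" if "l \<le> max n l" "t + 2 \<le> l" for l
    using that
  proof (induction rule: inc_induct)
    case base
    then show ?case by (intro trivial) simp
  next
    case (step k)
    have Q: "?Q (Suc k)" using step by simp
    have split: "E \<inter> {1..k} = E \<inter> {1..Suc k} - {Suc k}" for E by auto
    have "E - {Suc k} \<in> A" if "E \<in> A" for E
      using level_le[OF opt sh, of "Suc k" E] Q that step.prems by (cases "Suc k \<in> E") auto
    moreover have "E - {Suc k} \<in> B" if "E \<in> B" for E
      using level_le[OF optimal_sym[OF opt] sh(2,1), of "Suc k" E] Q that step.prems
      by (cases "Suc k \<in> E") auto
    ultimately show ?case using Q unfolding split by blast
  qed
  then show ?thesis using assms(4) by simp
qed

end

section \<open>Families depending on few coordinates\<close>

context sequence_space begin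

definition standard :: "nat set set \<Rightarrow> bool" where
  "standard X \<longleftrightarrow> (\<exists>T r. T \<subseteq> {1..n} \<and> card T = t + 2 * r \<and> (r = 0 \<or> r = 1 \<and> m = t + 1) \<and> X = slab T r)"

lemma wt_Un_le: "wt (A \<union> B) \<le> wt A + wt B" if "A \<subseteq> Pow {1..n}" "B \<subseteq> Pow {1..n}"
  using sum.union_inter[OF finite_family[OF that(1)] finite_family[OF that(2)], of "\<lambda>E. (m - 1) ^ (n - card E)"]
  unfolding wt_def by linarith

lemma Collect_subset_ground: "{E. E \<subseteq> {1..n} \<and> P E} \<subseteq> Pow {1..n}"
  by auto

text \<open>A \<open>t\<close>-set \<open>E0\<close> in \<open>A\<close> forces every member of
  \<open>B\<close> to contain \<open>E0\<close>. Should \<open>A\<close> have a member not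
  containing \<open>E0\<close>, then every member of \<open>B\<close> also meets
  \<open>U - E0\<close>, a set of at most two points; in each of the resulting cases the product is
  too small.\<close>

lemma concentrated:
  assumes opt: "optimal A B" and U: "U \<subseteq> {1..n}" "card U \<le> t + 2"
    and dep: "\<And>F. F \<in> B \<Longrightarrow> F \<inter> U \<in> B"
    and E0: "E0 \<in> A" "E0 \<subseteq> U" "card E0 = t"
  shows "A = slab E0 0" "B = slab E0 0"
proof -
  note C = crossD[OF optimalD(1)[OF opt]]
  have fin: "finite U" "finite E0" using finite_ground[OF U(1)] finite_subset[OF E0(2)] by auto
  have E0n: "E0 \<subseteq> {1..n}" using E0(2) U(1) by simp
  have full: "E0 \<subseteq> F" if "t \<le> card (F \<inter> E0)" for F
    using card_seteq[OF fin(2), of "F \<inter> E0"] that E0(3) by auto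
  have An: "E \<subseteq> {1..n}" if "E \<in> A" for E using C(1) that by blast
  have Bn: "F \<subseteq> {1..n}" if "F \<in> B" for F using C(2) that by blast
  have B0: "E0 \<subseteq> F" if "F \<in> B" for F
    using full[of F] C(5)[OF E0(1) that] by (simp add: Int_commute)
  have sub: "A \<subseteq> slab E0 0"
  proof (rule ccontr)
    assume "\<not> A \<subseteq> slab E0 0"
    then obtain E1 where E1: "E1 \<in> A" "\<not> E0 \<subseteq> E1"
      using slab_0[OF E0n E0(3)] An by blast
    \<comment> \<open>Otherwise truncation to \<open>U\<close> would put \<open>E0\<close> itself
      into \<open>B\<close>, although \<open>E1\<close> meets \<open>E0\<close> in fewer than
      \<open>t\<close> points.\<close>
    have meet: "F \<inter> (U - E0) \<noteq> {}" if "F \<in> B" for F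
    proof
      assume "F \<inter> (U - E0) = {}"
      then have "F \<inter> U = E0" using B0[OF that] E0(2) by auto
      then have "E0 \<in> B" using dep[OF that] by simp
      then show False using C(5)[OF E1(1)] full E1(2) by blast
    qed
    have "B \<noteq> {}" using optimal_wt(3)[OF opt] by (auto simp: wt_def)
    then obtain F where F: "F \<in> B" by blast
    have rest: "card (U - E0) \<le> 2" using card_Diff_subset[OF fin(2) E0(2)] E0(3) U(2) by simp
    obtain x where x: "x \<in> F" "x \<in> U" "x \<notin> E0" using meet[OF F] by blast
    have tn: "Suc t \<le> n"
    proof -
      have "card (insert x E0) = Suc t" using x fin E0(3) by simp
      then show ?thesis using card_ground[of "insert x E0"] x E0n U(1) by auto
    qed
    define L where "L = m ^ (n - Suc t)"
    have K: "m ^ (n - t) = m * L"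
    proof -
      have "n - t = Suc (n - Suc t)" using tn by simp
      then show ?thesis unfolding L_def by (metis power_Suc)
    qed
    have L: "0 < L" unfolding L_def using m by simp
    have low: "(m * L)\<^sup>2 \<le> wt A * wt B" using optimal_wt(1)[OF opt] K by simp
    have sup: "wt {E. E \<subseteq> {1..n} \<and> S \<subseteq> E} = L" if "S \<subseteq> {1..n}" "card S = Suc t" for S
      using wt_superset[OF that(1)] that(2) by (simp add: L_def)
    show False
    proof (cases "\<exists>F\<in>B. \<exists>x. F \<inter> (U - E0) = {x}")
      case True
      then obtain F x where F: "F \<in> B" "F \<inter> (U - E0) = {x}" by blast
      define V where "V = insert x E0"
      have x: "x \<in> U" "x \<notin> E0" using F(2) by auto
      have "F \<inter> U = V" using B0[OF F(1)] F(2) E0(2) by (auto simp: V_def)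
      then have VB: "V \<in> B" using dep[OF F(1)] by simp
      have V: "V \<subseteq> {1..n}" "card V = Suc t" "finite V"
        using Bn[OF VB] x fin E0(3) by (simp_all add: V_def)
      have wA: "wt A \<le> L * (1 + Suc t * (m - 1))"
      proof -
        have "A \<subseteq> {E. E \<subseteq> {1..n} \<and> t \<le> card (E \<inter> V)}" using An C(5)[OF _ VB] by blast
        from wt_mono[OF Collect_subset_ground this] show ?thesis
          unfolding wt_miss_one[OF V(1,2)] L_def .
      qed
      show False
      \<comment> \<open>If all of \<open>B\<close> contains \<open>V\<close>, the product is at most
        \<open>L * L * (1 + Suc t * (m - 1))\<close>, which is below \<open>(m * L)\<^sup>2\<close>
        because \<open>Suc t \<le> m\<close>.\<close>
      proof (cases "\<forall>F\<in>B. x \<in> F")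
        case True
        then have "B \<subseteq> {E. E \<subseteq> {1..n} \<and> V \<subseteq> E}" using B0 Bn unfolding V_def by blast
        from wt_mono[OF Collect_subset_ground this] have "wt B \<le> L" unfolding sup[OF V(1,2)] .
        then have "wt A * wt B \<le> L * (1 + Suc t * (m - 1)) * L" using wA by (intro mult_le_mono)
        with low have "(m * L)\<^sup>2 \<le> L * (1 + Suc t * (m - 1)) * L" by (rule order_trans)
        then have "m * m * (L * L) \<le> (1 + Suc t * (m - 1)) * (L * L)"
          by (simp only: power2_eq_square ac_simps)
        then have "m * m \<le> 1 + Suc t * (m - 1)"
          using mult_pos_pos[OF L L] unfolding mult_le_cancel2 by blast
        also have "Suc t * (m - 1) \<le> m * (m - 1)" using m by (intro mult_le_mono1) simp
        also have "m * (m - 1) = m * m - m" by (simp add: diff_mult_distrib2)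
        finally have "m * m \<le> 1 + (m * m - m)" by simp
        moreover have "m \<le> m * m" by simp
        ultimately show False using m t by linarith
      next
        case False
        then obtain F' where F': "F' \<in> B" "x \<notin> F'" by blast
        obtain y where y: "y \<in> F'" "y \<in> U" "y \<notin> E0" using meet[OF F'(1)] by blast
        then have "x \<noteq> y" using F'(2) by blast
        have "{x, y} = U - E0"
          using x y \<open>x \<noteq> y\<close> rest fin by (intro card_seteq) auto
        define V' where "V' = insert y E0"
        have "F' \<inter> U = V'"
          using B0[OF F'(1)] F'(2) y E0(2) \<open>{x, y} = U - E0\<close> by (auto simp: V'_def)
        then have V'B: "V' \<in> B" using dep[OF F'(1)] by simp
        have V': "V' \<subseteq> {1..n}" "card V' = Suc t" "finite V'"
          using Bn[OF V'B] y fin E0(3) by (simp_all add: V'_def)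
        \<comment> \<open>Now both one-point extensions \<open>V\<close> and \<open>V'\<close> of
          \<open>E0\<close> lie in \<open>B\<close>. The target is \<open>2 * L\<close> for
          \<open>B\<close> and \<open>2 * m * L\<close> for \<open>A\<close>, with product less than
          \<open>(m * L)\<^sup>2\<close> as soon as \<open>m > 4\<close>.\<close>
        let ?S = "\<lambda>S. {E. E \<subseteq> {1..n} \<and> S \<subseteq> E}"
        let ?G = "\<lambda>e. insert x (insert y (E0 - {e}))"
        have "V \<subseteq> G \<or> V' \<subseteq> G" if "G \<in> B" for G
          using meet[OF that] B0[OF that]
          unfolding V_def V'_def \<open>{x, y} = U - E0\<close>[symmetric] by blast
        then have "B \<subseteq> ?S V \<union> ?S V'" using Bn by blast
        then have "wt B \<le> wt (?S V \<union> ?S V')" by (rule wt_mono[rotated]) auto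
        also have "\<dots> \<le> wt (?S V) + wt (?S V')" by (rule wt_Un_le) auto
        finally have wB: "wt B \<le> 2 * L" using sup V V' by simp
        \<comment> \<open>An \<open>E\<close> that misses \<open>e\<close> from \<open>E0\<close>
          can afford no other loss against either \<open>V\<close> or \<open>V'\<close>, so it
          contains all of both except \<open>e\<close>.\<close>
        have cover: "E0 \<subseteq> E \<or> (\<exists>e\<in>E0. ?G e \<subseteq> E)" if "E \<in> A" for E
        proof (rule disjCI)
          assume "\<not> (\<exists>e\<in>E0. ?G e \<subseteq> E)"
          show "E0 \<subseteq> E"
          proof (rule ccontr)
            assume "\<not> E0 \<subseteq> E"
            then obtain e where e: "e \<in> E0" "e \<notin> E" by blast
            have "W - {e} \<subseteq> E" if "W \<in> B" "card W = Suc t" "finite W" "e \<in> W" for W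
            proof -
              have "E \<inter> W = W - {e}"
              proof (rule card_seteq)
                show "card (W - {e}) \<le> card (E \<inter> W)"
                  using C(5)[OF \<open>E \<in> A\<close> that(1)] that by simp
              qed (use that e in auto)
              then show ?thesis by blast
            qed
            from this[OF VB V(2,3)] this[OF V'B V'(2,3)] have "?G e \<subseteq> E"
              using e x y unfolding V_def V'_def by blast
            then show False using \<open>\<not> (\<exists>e\<in>E0. ?G e \<subseteq> E)\<close> e by blast
          qed
        qed
        have "A \<subseteq> ?S E0 \<union> (\<Union>e\<in>E0. ?S (?G e))"
        proof
          fix E assume E: "E \<in> A"
          show "E \<in> ?S E0 \<union> (\<Union>e\<in>E0. ?S (?G e))" using cover[OF E] An[OF E] by simp
        qed
        then have "wt A \<le> wt (?S E0 \<union> (\<Union>e\<in>E0. ?S (?G e)))" by (rule wt_mono[rotated]) auto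
        also have "\<dots> \<le> wt (?S E0) + wt (\<Union>e\<in>E0. ?S (?G e))" by (rule wt_Un_le) auto
        also have "wt (\<Union>e\<in>E0. ?S (?G e)) \<le> (\<Sum>e\<in>E0. wt (?S (?G e)))"
          by (rule wt_UN_le[OF fin(2)]) auto
        also have "\<dots> = (\<Sum>e\<in>E0. L)"
        proof (rule sum.cong)
          fix e assume e: "e \<in> E0"
          have "card (?G e) = Suc t"
            using e x y \<open>x \<noteq> y\<close> fin E0(3) card_Suc_Diff1[OF fin(2) e] by simp
          moreover have "?G e \<subseteq> {1..n}" using V(1) V'(1) unfolding V_def V'_def by blast
          ultimately show "wt (?S (?G e)) = L" by (intro sup)
        qed simp
        also have "\<dots> = t * L" using E0(3) by simp
        also have "wt (?S E0) = m * L" using wt_superset[OF E0n] E0(3) K by simp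
        finally have "wt A \<le> m * L + t * L" by simp
        also have "\<dots> \<le> 2 * m * L" using m by (simp add: distrib_right[symmetric])
        finally have "wt A * wt B \<le> (2 * m * L) * (2 * L)" using wB by (intro mult_le_mono)
        with low have "(m * L)\<^sup>2 \<le> (2 * m * L) * (2 * L)" by (rule order_trans)
        then have "m * (m * (L * L)) \<le> 4 * (m * (L * L))"
          by (simp add: power2_eq_square ac_simps)
        then have "m \<le> 4" using L m unfolding mult_le_cancel2 by simp
        then show False using m t by simp
      qed
    next
      case False
      \<comment> \<open>With no member of \<open>B\<close> meeting \<open>U - E0\<close> in a single
        point, every member contains both points and thus \<open>U\<close>. This makes
        \<open>B\<close> light, while \<open>A\<close> is bounded by the union over all
        \<open>t\<close>-subsets of \<open>U\<close>.\<close>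
      have all: "U \<subseteq> G" "card (U - E0) = 2" if "G \<in> B" for G
      proof -
        have "card (G \<inter> (U - E0)) \<noteq> 0" using meet[OF that] fin by simp
        moreover have "card (G \<inter> (U - E0)) \<noteq> 1" using False that by (auto simp: card_1_singleton_iff)
        ultimately have "2 \<le> card (G \<inter> (U - E0))" by linarith
        moreover from this have *: "G \<inter> (U - E0) = U - E0"
          using rest fin by (intro card_seteq) auto
        ultimately show "card (U - E0) = 2" using rest by simp
        show "U \<subseteq> G" using * B0[OF that] by blast
      qed
      have Ut: "card U = t + 2"
        using all(2)[OF F] card_Diff_subset[OF fin(2) E0(2)] E0(3) by simp
      have "F \<inter> U = U" using all(1)[OF F] by blast
      then have UB: "U \<in> B" using dep[OF F] by simp
      have tn2: "t + 2 \<le> n" using card_ground[OF U(1)] Ut by simp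
      define M where "M = m ^ (n - (t + 2))"
      have LM: "L = m * M"
      proof -
        have "n - Suc t = Suc (n - (t + 2))" using tn2 by simp
        then show ?thesis unfolding L_def M_def by (metis power_Suc)
      qed
      have M: "0 < M" unfolding M_def using m by simp
      let ?S = "\<lambda>S. {E. E \<subseteq> {1..n} \<and> S \<subseteq> E}"
      let ?I = "{S. S \<subseteq> U \<and> card S = t}"
      have "B \<subseteq> ?S U" using all(1) Bn by blast
      from wt_mono[OF Collect_subset_ground this] have wB: "wt B \<le> M"
        unfolding wt_superset[OF U(1)] Ut M_def .
      have cover: "\<exists>S\<in>?I. S \<subseteq> E" if "E \<in> A" for E
      proof -
        have "t \<le> card (E \<inter> U)" using C(5) that UB by blast
        then obtain S where "S \<subseteq> E \<inter> U" "card S = t" by (rule obtain_subset_with_card_n)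
        then show ?thesis by blast
      qed
      have "A \<subseteq> (\<Union>S\<in>?I. ?S S)"
      proof
        fix E assume E: "E \<in> A"
        show "E \<in> (\<Union>S\<in>?I. ?S S)" using cover[OF E] An[OF E] by simp
      qed
      then have "wt A \<le> wt (\<Union>S\<in>?I. ?S S)" by (rule wt_mono[rotated]) auto
      also have "\<dots> \<le> (\<Sum>S\<in>?I. wt (?S S))"
        using fin by (intro wt_UN_le) auto
      also have "\<dots> = (\<Sum>S\<in>?I. m * L)"
      proof (rule sum.cong)
        fix S assume "S \<in> ?I"
        then have "S \<subseteq> {1..n}" "card S = t" using U(1) by auto
        then show "wt (?S S) = m * L" using wt_superset K by simp
      qed simp
      also have "\<dots> = (t + 2 choose t) * (m * L)" using n_subsets[OF fin(1), of t] Ut by simp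
      finally have "wt A * wt B \<le> (t + 2 choose t) * (m * L) * M" using wB by (intro mult_le_mono)
      with low have "(m * L)\<^sup>2 \<le> (t + 2 choose t) * (m * L) * M" by (rule order_trans)
      then have "(m * m) * (m * m * (M * M)) \<le> (t + 2 choose t) * (m * m * (M * M))"
        unfolding LM by (simp only: power2_eq_square ac_simps)
      then have "m * m \<le> t + 2 choose t" using m M unfolding mult_le_cancel2 by simp
      also have "t + 2 choose t = (t + 2) * (t + 1) div 2"
        using binomial_symmetric[of t "t + 2"] choose_two[of "t + 2"] by simp
      \<comment> \<open>The binomial coefficient is at most about half of \<open>m * m\<close>,
        because \<open>t + 1 \<le> m\<close>; this contradicts the preceding bound.\<close>
      also have "\<dots> \<le> (m + 1) * m div 2" using m by (intro div_le_mono mult_le_mono) auto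
      finally have "m * m * 2 \<le> (m + 1) * m div 2 * 2" by (rule mult_le_mono1)
      also have "\<dots> \<le> (m + 1) * m" by (rule div_times_less_eq_dividend)
      finally have "m * m \<le> 1 * m" by (simp add: algebra_simps)
      then show False using m t unfolding mult_le_cancel2 by simp
    qed
  qed
  have subB: "B \<subseteq> slab E0 0" using slab_0[OF E0n E0(3)] B0 Bn by blast
  show "A = slab E0 0" "B = slab E0 0"
    using optimal_extend[OF opt sub subB cross_slab[OF E0n]] E0(3) by simp_all
qed

text \<open>A member with at most \<open>t\<close> points in \<open>U\<close> has, after truncation,
  exactly \<open>t\<close> points, and \<open>concentrated\<close> applies. Otherwise all traces
  have at least \<open>t + 1\<close> points, which leaves only the slab on \<open>U\<close> with
  \<open>r = 1\<close> or families whose members all contain \<open>U\<close>.\<close>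

lemma optimal_core:
  assumes opt: "optimal A B" and U: "U \<subseteq> {1..n}" "card U \<le> t + 2"
    and dep: "\<And>E. E \<in> A \<Longrightarrow> E \<inter> U \<in> A" "\<And>F. F \<in> B \<Longrightarrow> F \<inter> U \<in> B"
  shows "A = B \<and> standard A"
proof -
  have small: "A = B \<and> standard A"
    if opt: "optimal A B" and dep: "\<And>E. E \<in> A \<Longrightarrow> E \<inter> U \<in> A" "\<And>F. F \<in> B \<Longrightarrow> F \<inter> U \<in> B"
      and E: "E \<in> A" "card (E \<inter> U) \<le> t" for A B E
  proof -
    have "B \<noteq> {}" using optimal_wt(3)[OF opt] by (auto simp: wt_def)
    then obtain F where F: "F \<in> B" by blast
    have E0: "E \<inter> U \<in> A" using dep E by blast
    have fin: "finite (E \<inter> U)" using finite_ground[OF U(1)] by simp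
    have "t \<le> card ((E \<inter> U) \<inter> F)" using crossD(5)[OF optimalD(1)[OF opt] E0 F] .
    also have "\<dots> \<le> card (E \<inter> U)" by (rule card_mono[OF fin]) blast
    finally have t': "card (E \<inter> U) = t" using E(2) by simp
    have "A = slab (E \<inter> U) 0" "B = slab (E \<inter> U) 0"
      using concentrated[OF opt U dep(2) E0 _ t'] by simp_all
    moreover have "standard (slab (E \<inter> U) 0)"
      unfolding standard_def using U(1) t' by (intro exI[of _ "E \<inter> U"] exI[of _ 0]) auto
    ultimately show ?thesis by simp
  qed
  consider "\<exists>E\<in>A. card (E \<inter> U) \<le> t" | "\<exists>F\<in>B. card (F \<inter> U) \<le> t"
    | "\<forall>E\<in>A \<union> B. t + 1 \<le> card (E \<inter> U)" by (metis Suc_eq_plus1 UnE not_less_eq_eq)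
  then show ?thesis
  proof cases
    case 1 then show ?thesis using small[OF opt dep] by blast
  next
    case 2
    then obtain F where "F \<in> B" "card (F \<inter> U) \<le> t" by blast
    from small[OF optimal_sym[OF opt] dep(2,1) this] show ?thesis by auto
  next
    case 3
    note C = crossD[OF optimalD(1)[OF opt]]
    have fin: "finite U" using finite_ground[OF U(1)] .
    have sub: "A \<subseteq> slab U 1" "B \<subseteq> slab U 1" using 3 C(1,2) unfolding slab_def by auto
    show ?thesis
    proof (cases "card U = t + 2")
      case True
      have eq: "A = slab U 1" "B = slab U 1"
        using optimal_extend[OF opt sub cross_slab[OF U(1)]] True by simp_all
      define M where "M = m ^ (n - (t + 2))"
      have M: "0 < M" unfolding M_def using m by simp
      have "t + 2 \<le> n" using card_ground[OF U(1)] True by simp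
      then have "n - t = n - (t + 2) + 2" by simp
      then have K: "m ^ (n - t) = M * (m * m)" unfolding M_def by (simp add: power_add power2_eq_square)
      have "(m ^ (n - t))\<^sup>2 \<le> (wt (slab U 1))\<^sup>2"
        using optimal_wt(1)[OF opt] unfolding eq power2_eq_square .
      then have "M * (m * m) \<le> M * (1 + (t + 2) * (m - 1))"
        using wt_slab_1[OF U(1) True] unfolding K M_def[symmetric] by (simp add: power2_nat_le_eq_le)
      then have le: "m * m \<le> 1 + (t + 2) * (m - 1)" using M unfolding mult_le_cancel1 by blast
      \<comment> \<open>In terms of \<open>q = m - 1\<close> the comparison reads
        \<open>q * (q + 2) \<le> q * (t + 2)\<close>, which leaves only \<open>m = t + 1\<close> for
        this slab.\<close>
      obtain q where q: "m = q + 1" "0 < q" using m t that[of "m - 1"] by auto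
      have "q * (q + 2) \<le> q * (t + 2)" using le q by (simp add: algebra_simps)
      then have "m \<le> t + 1" using q by simp
      then have "standard (slab U 1)"
        unfolding standard_def using U True m by (intro exI[of _ U] exI[of _ 1]) auto
      then show ?thesis using eq by simp
    next
      case False
      \<comment> \<open>Here \<open>U\<close> has at most \<open>t + 1\<close> points, while every
        trace has at least that many.\<close>
      have full: "E \<inter> U = U" if "E \<in> A \<union> B" for E
      proof (rule card_seteq[OF fin])
        show "card U \<le> card (E \<inter> U)" using bspec[OF 3 that] False U(2) by linarith
      qed simp
      have "A \<noteq> {}" using optimal_wt(2)[OF opt] by (auto simp: wt_def)
      then have "t \<le> card U" using 3 full by fastforce
      then obtain T where T: "T \<subseteq> U" "card T = t" by (meson obtain_subset_with_card_n)
      have Tn: "T \<subseteq> {1..n}" using T U by blast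
      have "T \<subseteq> E" if "E \<in> A \<union> B" for E using full[OF that] T(1) by blast
      then have sub: "A \<subseteq> slab T 0" "B \<subseteq> slab T 0"
        unfolding slab_0[OF Tn T(2)] using C(1,2) by auto
      have "A = slab T 0" "B = slab T 0"
        using optimal_extend[OF opt sub cross_slab[OF Tn]] T(2) by simp_all
      moreover have "standard (slab T 0)"
        unfolding standard_def using T Tn by (intro exI[of _ T] exI[of _ 0]) auto
      ultimately show ?thesis by simp
    qed
  qed
qed

lemma optimal_shifted:
  assumes opt: "optimal A B" and sh: "shifted A" "shifted B"
  shows "A = B \<and> standard A"
proof (rule optimal_core[OF opt])
  let ?U = "{1..t + 2} \<inter> {1..n}"
  note C = crossD[OF optimalD(1)[OF opt]]
  show "?U \<subseteq> {1..n}" by simp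
  show "card ?U \<le> t + 2" using card_mono[of "{1..t + 2}" ?U] by simp
  have eq: "E \<inter> ?U = E \<inter> {1..t + 2}" if "E \<subseteq> {1..n}" for E using that by blast
  show "E \<inter> ?U \<in> A" if "E \<in> A" for E
    using dependence[OF opt sh le_refl] that eq[of E] C(1) by auto
  show "E \<inter> ?U \<in> B" if "E \<in> B" for E
    using dependence[OF opt sh le_refl] that eq[of E] C(2) by auto
qed

end

section \<open>Undoing the shifts\<close>

lemma transpose_image:
  assumes "j \<in> E" "i \<notin> E"
  shows "Transposition.transpose i j ` E = insert i (E - {j})"
proof -
  have "k \<in> Transposition.transpose i j ` E \<longleftrightarrow> Transposition.transpose i j k \<in> E" for k
    by (metis image_iff transpose_involutory)
  then show ?thesis
    using assms by (auto simp: set_eq_iff) (auto simp: Transposition.transpose_def split: if_splits)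
qed

definition shift :: "nat \<Rightarrow> nat \<Rightarrow> nat set set \<Rightarrow> nat set set" where
  "shift i j = compression.comp (\<lambda>E. Transposition.transpose i j ` E) {E. j \<in> E \<and> i \<notin> E}"

context sequence_space begin

context
  fixes i j :: nat
  assumes ij: "i \<in> {1..n}" "j \<in> {1..n}" "i \<noteq> j"
begin

interpretation compression "\<lambda>E. Transposition.transpose i j ` E" "{E. j \<in> E \<and> i \<notin> E}" "\<lambda>E F. card (E \<inter> F)"
  using compression_shift[OF ij(3)] .

lemma transpose_ground: "Transposition.transpose i j ` {1..n} = {1..n}"
  using ij by (simp add: transpose_image_eq)

lemma transpose_subset:
  assumes "E \<subseteq> {1..n}"
  shows "Transposition.transpose i j ` E \<subseteq> {1..n}"
  using image_mono[OF assms, of "Transposition.transpose i j"] unfolding transpose_ground .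

lemma optimal_shift:
  assumes opt: "optimal A B"
  shows "optimal (shift i j A) (shift i j B)"
proof -
  note C = crossD[OF optimalD(1)[OF opt]]
  have sub: "shift i j A \<subseteq> Pow {1..n}" if "A \<subseteq> Pow {1..n}" for A
    unfolding shift_def using transpose_subset by (intro comp_subset[OF that]) auto
  have "cross (shift i j A) (shift i j B)"
    unfolding cross_def using sub[OF C(1)] sub[OF C(2)] comp_cross[of A B t, OF C(5)]
    unfolding shift_def by blast
  moreover have "wt (shift i j A) = wt A" for A
    unfolding wt_def shift_def by (rule sum_comp) (simp add: card_image)
  ultimately show ?thesis using optimalD(2)[OF opt] unfolding optimal_def by simp
qed

lemma shift_decreases:
  assumes A: "A \<subseteq> Pow {1..n}" and "i < j"
  shows "(\<Sum>E\<in>shift i j A. \<Sum>E) \<le> (\<Sum>E\<in>A. \<Sum>E)"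
    and "shift i j A \<noteq> A \<Longrightarrow> (\<Sum>E\<in>shift i j A. \<Sum>E) < (\<Sum>E\<in>A. \<Sum>E)"
proof -
  have less: "\<Sum>(Transposition.transpose i j ` E) < \<Sum>E" if "E \<in> A" "E \<in> {E. j \<in> E \<and> i \<notin> E}" for E
  proof -
    have E: "j \<in> E" "i \<notin> E" "finite E" using that A finite_ground[of E] by auto
    then have "\<Sum>(Transposition.transpose i j ` E) = i + \<Sum>(E - {j})"
      by (simp add: transpose_image)
    also have "\<dots> < j + \<Sum>(E - {j})" using \<open>i < j\<close> by simp
    also have "\<dots> = \<Sum>E" using E by (simp add: sum.remove)
    finally show ?thesis .
  qed
  show "(\<Sum>E\<in>shift i j A. \<Sum>E) \<le> (\<Sum>E\<in>A. \<Sum>E)"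
    unfolding shift_def by (rule comp_decreases(1)[where h = "\<lambda>E. \<Sum>E", OF finite_family[OF A] less])
  show "shift i j A \<noteq> A \<Longrightarrow> (\<Sum>E\<in>shift i j A. \<Sum>E) < (\<Sum>E\<in>A. \<Sum>E)"
    unfolding shift_def by (rule comp_decreases(2)[where h = "\<lambda>E. \<Sum>E", OF finite_family[OF A] less])
qed

lemma shift_fixed:
  assumes "shift i j A = A" "E \<in> A" "j \<in> E" "i \<notin> E"
  shows "insert i (E - {j}) \<in> A"
  using comp_dom[of E A] assms unfolding shift_def by (simp add: transpose_image)

lemma transpose_slab: "(\<lambda>E. Transposition.transpose i j ` E) ` slab T r = slab (Transposition.transpose i j ` T) r"
proof -
  let ?f = "\<lambda>E. Transposition.transpose i j ` E"
  have sub: "?f E \<in> slab (?f T) r" if "E \<in> slab T r" for E T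
  proof -
    have "card (?f E \<inter> ?f T) = card (E \<inter> T)"
      by (simp add: image_Int[symmetric] card_image)
    then show ?thesis using that transpose_subset unfolding slab_def by auto
  qed
  show ?thesis
  proof (intro equalityI subsetI)
    fix E assume "E \<in> slab (?f T) r"
    then have "?f E \<in> slab T r" using sub[of E "?f T"] by simp
    moreover have "E = ?f (?f E)" by simp
    ultimately show "E \<in> ?f ` slab T r" by (rule rev_image_eqI)
  qed (use sub in auto)
qed

text \<open>An application of \<open>comp_reverse\<close>: the preimages are the slab itself or its
  image under the transposition, which is the slab on the transposed \<open>T\<close>.\<close>

lemma shift_reverse:
  assumes cross: "cross A B" and T: "T \<subseteq> {1..n}" "card T = t + 2 * r" "r \<le> 1"
    and AB: "shift i j A = slab T r" "shift i j B = slab T r"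
  obtains T' where "T' \<subseteq> {1..n}" "card T' = t + 2 * r" "A = slab T' r" "B = slab T' r"
proof -
  let ?f = "\<lambda>E. Transposition.transpose i j ` E"
  let ?P = "{g \<in> {E. j \<in> E \<and> i \<notin> E}. g \<notin> slab T r \<and> ?f g \<in> slab T r}"
  have fin: "finite T" using finite_ground[OF T(1)] .
  \<comment> \<open>The swap lifts \<open>g\<close> across the threshold of the slab. This is
    possible only if it brings in a point of \<open>T\<close> without removing one, and then
    \<open>g\<close> was exactly one point short.\<close>
  have P: "i \<in> T" "j \<notin> T" "i \<notin> g" "j \<in> g" "card (g \<inter> T) = t + r - 1" "?f g = insert i (g - {j})" if "g \<in> ?P" for g
  proof -
    show g: "i \<notin> g" "j \<in> g" using that by auto
    show f: "?f g = insert i (g - {j})" by (rule transpose_image[OF g(2,1)])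
    have "?f g \<in> slab T r" "g \<notin> slab T r" using that by blast+
    then have fg: "insert i (g - {j}) \<subseteq> {1..n}" and ge: "t + r \<le> card (insert i (g - {j}) \<inter> T)"
      and g_out: "g \<subseteq> {1..n} \<Longrightarrow> \<not> t + r \<le> card (g \<inter> T)"
      unfolding f slab_def by blast+
    have "g \<subseteq> insert j (insert i (g - {j}))" by blast
    also have "\<dots> \<subseteq> {1..n}" using insert_subsetI[OF ij(2) fg] .
    finally have lt: "card (g \<inter> T) < t + r" using g_out by (simp add: not_le)
    show i: "i \<in> T"
    proof (rule ccontr)
      assume "i \<notin> T"
      then have "card (insert i (g - {j}) \<inter> T) \<le> card (g \<inter> T)" using fin by (intro card_mono) auto
      then show False using lt ge by simp
    qed
    show j: "j \<notin> T"
    proof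
      assume "j \<in> T"
      then have "insert i (g - {j}) \<inter> T = insert i (g \<inter> T - {j})" using i by auto
      moreover have "card (insert i (g \<inter> T - {j})) = card (g \<inter> T)"
        using g fin \<open>j \<in> T\<close> by (intro card_exchange) auto
      ultimately show False using lt ge by simp
    qed
    have "insert i (g - {j}) \<inter> T = insert i (g \<inter> T)" using i j by auto
    then show "card (g \<inter> T) = t + r - 1" using ge lt g fin by simp
  qed
  have nbr: "\<exists>h\<in>?P. card (?f g \<inter> h) < t \<and> card (?f g' \<inter> h) < t" if g: "g \<in> ?P" "g' \<in> ?P" for g g'
  proof -
    note Pg = P[OF g(1)] and Pg' = P[OF g(2)]
    define Q where "Q = T - {i}"
    have Q: "finite Q" "card Q = t + 2 * r - 1" using fin Pg(1) T(2) by (simp_all add: Q_def)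
    have gT: "g \<inter> T \<subseteq> Q" "g' \<inter> T \<subseteq> Q" using Pg(3) Pg'(3) by (auto simp: Q_def)
    have "card (g \<inter> T) + card (g' \<inter> T) = card ((g \<inter> T) \<union> (g' \<inter> T)) + card ((g \<inter> T) \<inter> (g' \<inter> T))"
      using fin by (intro card_Un_Int) auto
    moreover have "card ((g \<inter> T) \<union> (g' \<inter> T)) \<le> card Q"
      using Q gT by (intro card_mono) auto
    \<comment> \<open>Two sets of size \<open>t + r - 1\<close> inside \<open>Q\<close>, which has
      \<open>t + 2 * r - 1\<close> points, share at least \<open>t - 1 \<ge> r\<close>
      points.\<close>
    ultimately have "r \<le> card ((g \<inter> T) \<inter> (g' \<inter> T))" using Pg(5) Pg'(5) Q(2) t T(3) by linarith
    then obtain R where R: "R \<subseteq> (g \<inter> T) \<inter> (g' \<inter> T)" "card R = r" "finite R"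
      by (rule obtain_subset_with_card_n)
    have RQ: "R \<subseteq> Q" using R(1) gT by blast
    \<comment> \<open>The common neighbour: it avoids \<open>r\<close> points shared by
      \<open>g\<close> and \<open>g'\<close>, so each of the two shifted sets keeps at most
      \<open>t - 1\<close> points in common with it. Containing \<open>j\<close> but not
      \<open>i\<close>, it lies one point below the threshold.\<close>
    define h where "h = insert j (Q - R)"
    have jh: "i \<notin> h" "j \<in> h" using ij(3) by (auto simp: h_def Q_def)
    have fh: "?f h = insert i (h - {j})" by (rule transpose_image[OF jh(2,1)])
    have "h \<inter> T = Q - R" using Pg(2) by (auto simp: h_def Q_def)
    then have hT: "card (h \<inter> T) = t + r - 1"
      using card_Diff_subset[OF R(3) RQ] Q(2) R(2) by simp
    have fhT: "?f h \<inter> T = insert i (h \<inter> T)" unfolding fh using Pg(1,2) by auto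
    have "h \<subseteq> {1..n}" unfolding h_def Q_def using ij(2) T(1) by blast
    then have "?f h \<subseteq> {1..n}" by (rule transpose_subset)
    moreover have "card (?f h \<inter> T) = t + r" using fhT hT fin jh(1) t by simp
    ultimately have "?f h \<in> slab T r" unfolding slab_def by simp
    moreover have "\<not> t + r \<le> card (h \<inter> T)" using hT t by linarith
    then have "h \<notin> slab T r" by (simp add: slab_def)
    ultimately have hP: "h \<in> ?P" using jh by simp
    have "card (?f g \<inter> h) < t" if "g \<in> ?P" "R \<subseteq> g \<inter> T" for g
    proof -
      have "?f g \<inter> h \<subseteq> g \<inter> T - R" unfolding P(6)[OF that(1)] using jh(1) by (auto simp: h_def Q_def)
      then have "card (?f g \<inter> h) \<le> card (g \<inter> T - R)" using fin by (intro card_mono) auto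
      also have "\<dots> = t - 1" using card_Diff_subset[OF R(3) that(2)] P(5)[OF that(1)] R(2) by simp
      finally show ?thesis using t by linarith
    qed
    then have "card (?f g \<inter> h) < t" "card (?f g' \<inter> h) < t" using g R(1) by blast+
    then show ?thesis using hP by blast
  qed
  from comp_reverse[of A B t "slab T r", OF crossD(5)[OF cross] AB[unfolded shift_def] nbr]
  consider "A = slab T r" "B = slab T r" | "A = ?f ` slab T r" "B = ?f ` slab T r"
    by blast
  then show ?thesis
  proof cases
    case 1
    then show ?thesis using that T by blast
  next
    case 2
    have "card (?f T) = t + 2 * r" using T(2) by (simp add: card_image)
    then show ?thesis using that[of "?f T"] 2 transpose_subset[OF T(1)] unfolding transpose_slab by blast
  qed
qed

end

section \<open>Classification of all optimal pairs of set families\<close>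

lemma optimal_standard: "optimal A B \<Longrightarrow> A = B \<and> standard A"
proof (induction "(\<Sum>E\<in>A. \<Sum>E) + (\<Sum>E\<in>B. \<Sum>E)" arbitrary: A B rule: less_induct)
  case (less A B)
  note C = crossD[OF optimalD(1)[OF less.prems]]
  show ?case
  proof (cases "\<exists>i j. i \<in> {1..n} \<and> j \<in> {1..n} \<and> i < j \<and> (shift i j A \<noteq> A \<or> shift i j B \<noteq> B)")
    case True
    then obtain i j where ij: "i \<in> {1..n}" "j \<in> {1..n}" "i < j" "shift i j A \<noteq> A \<or> shift i j B \<noteq> B"
      by blast
    then have ne: "i \<noteq> j" by simp
    note dec = shift_decreases[OF ij(1,2) ne _ ij(3)]
    have "(\<Sum>E\<in>shift i j A. \<Sum>E) + (\<Sum>E\<in>shift i j B. \<Sum>E) < (\<Sum>E\<in>A. \<Sum>E) + (\<Sum>E\<in>B. \<Sum>E)"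
      using dec[OF C(1)] dec[OF C(2)] ij(4) by linarith
    from less.hyps[OF this optimal_shift[OF ij(1,2) ne less.prems]]
    have eq: "shift i j A = shift i j B" and "standard (shift i j A)" by blast+
    then obtain T r where T: "T \<subseteq> {1..n}" "card T = t + 2 * r" "r = 0 \<or> r = 1 \<and> m = t + 1"
      "shift i j A = slab T r" unfolding standard_def by blast
    then have "r \<le> 1" by auto
    obtain T' where "T' \<subseteq> {1..n}" "card T' = t + 2 * r" "A = slab T' r" "B = slab T' r"
      using shift_reverse[OF ij(1,2) ne optimalD(1)[OF less.prems] T(1,2) \<open>r \<le> 1\<close> T(4)] T(4) eq by metis
    then show ?thesis using T(3) unfolding standard_def by blast
  next
    case False
    have "shifted X" if X: "X \<subseteq> Pow {1..n}" "\<And>i j. i \<in> {1..n} \<Longrightarrow> j \<in> {1..n} \<Longrightarrow> i < j \<Longrightarrow> shift i j X = X" for X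
      unfolding shifted_def
    proof (intro ballI allI impI)
      fix E i j assume E: "E \<in> X" "1 \<le> i" "i < j" "j \<in> E" "i \<notin> E"
      have "j \<in> {1..n}" using E X(1) by blast
      then have ij: "i \<in> {1..n}" "j \<in> {1..n}" "i \<noteq> j" using E by auto
      show "insert i (E - {j}) \<in> X"
        using shift_fixed[OF ij X(2)[OF ij(1,2) E(3)] E(1,4,5)] .
    qed
    then have "shifted A" "shifted B" using False C(1,2) by blast+
    then show ?thesis using optimal_shifted[OF less.prems] by blast
  qed
qed

lemma wt_standard:
  assumes "standard X"
  shows "wt X = m ^ (n - t)"
proof -
  obtain T r where T: "T \<subseteq> {1..n}" "card T = t + 2 * r" "r = 0 \<or> r = 1 \<and> m = t + 1" "X = slab T r"
    using assms unfolding standard_def by blast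
  show ?thesis
  proof (cases "r = 0")
    case True
    then show ?thesis using T wt_slab_0 by simp
  next
    case False
    then have r: "r = 1" "m = t + 1" using T(3) by auto
    have "t + 2 \<le> n" using card_ground[OF T(1)] T(2) r by simp
    then have "n - t = n - (t + 2) + 2" by simp
    then have "m ^ (n - t) = m ^ (n - (t + 2)) * (m * m)" by (simp add: power_add power2_eq_square)
    \<comment> \<open>With \<open>m = t + 1\<close> both sides equal \<open>(t + 1)\<^sup>2\<close>;
      this is where the slabs with \<open>r = 0\<close> and \<open>r = 1\<close> have equal
      weight.\<close>
    also have "m * m = 1 + (t + 2) * (m - 1)" unfolding r by (simp add: algebra_simps)
    finally show ?thesis using wt_slab_1[OF T(1)] T r by simp
  qed
qed

text \<open>There are finitely many cross-intersecting pairs, so an optimal one exists, and its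
  classification computes the maximum. A pair attaining that value is then optimal itself.\<close>

theorem cross_wt:
  assumes "cross A B"
  shows "wt A * wt B \<le> (m ^ (n - t))\<^sup>2"
    and "wt A * wt B = (m ^ (n - t))\<^sup>2 \<Longrightarrow> A = B \<and> standard A"
proof -
  let ?I = "{(A, B). cross A B}"
  let ?w = "\<lambda>(A, B). wt A * wt B"
  have "?I \<subseteq> Pow (Pow {1..n}) \<times> Pow (Pow {1..n})" unfolding cross_def by blast
  then have fin: "finite ?I" by (rule finite_subset) simp
  have ne: "?I \<noteq> {}" using assms by blast
  have "Max (?w ` ?I) \<in> ?w ` ?I" using fin ne by (intro Max_in) auto
  then obtain X Y where XY: "cross X Y" "wt X * wt Y = Max (?w ` ?I)" by auto
  have max: "wt A' * wt B' \<le> wt X * wt Y" if "cross A' B'" for A' B'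
    unfolding XY(2) using fin that by (intro Max_ge) auto
  then have "optimal X Y" using XY(1) unfolding optimal_def by blast
  then have K: "wt X * wt Y = (m ^ (n - t))\<^sup>2"
    using optimal_standard wt_standard by (auto simp: power2_eq_square)
  show "wt A * wt B \<le> (m ^ (n - t))\<^sup>2" using max[OF assms] K by simp
  assume "wt A * wt B = (m ^ (n - t))\<^sup>2"
  then have "optimal A B" using assms max K unfolding optimal_def by simp
  then show "A = B \<and> standard A" by (rule optimal_standard)
qed

end

section \<open>Sequences\<close>

definition compress :: "nat \<Rightarrow> nat \<Rightarrow> (nat \<Rightarrow> nat) set \<Rightarrow> (nat \<Rightarrow> nat) set" where
  "compress i v = compression.comp (\<lambda>a. a(i := Transposition.transpose 1 v (a i))) {a. a i = v}"

lemma finite_seqs: "finite (seqs m n)"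
  unfolding seqs_def by (intro finite_PiE) auto

lemma seqs_range: "a \<in> seqs m n \<Longrightarrow> k \<in> {1..n} \<Longrightarrow> a k \<in> {1..m}"
  unfolding seqs_def by (rule PiE_mem)

lemma seqs_update: "a \<in> seqs m n \<Longrightarrow> i \<in> {1..n} \<Longrightarrow> x \<in> {1..m} \<Longrightarrow> a(i := x) \<in> seqs m n"
  unfolding seqs_def by (auto simp: PiE_iff extensional_def)

lemma restrict_seqs: "(\<And>k. k \<in> {1..n} \<Longrightarrow> f k \<in> {1..m}) \<Longrightarrow> (\<lambda>k\<in>{1..n}. f k) \<in> seqs m n"
  unfolding seqs_def by (rule restrict_PiE_iff[THEN iffD2]) blast

lemma seqs_eqI:
  assumes "a \<in> seqs m n" "b \<in> seqs m n" "\<And>k. k \<in> {1..n} \<Longrightarrow> a k = b k"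
  shows "a = b"
  by (rule PiE_ext[OF assms(1,2)[unfolded seqs_def] assms(3)])

lemma isomorphic_card:
  assumes AX: "A \<subseteq> seqs m n" "X \<subseteq> seqs m n" and "isomorphic m n A X"
  shows "card A = card X"
proof -
  obtain f g where f: "\<forall>i\<in>{1..n}. f i permutes {1..m}" and g: "g permutes {1..n}"
    and eq: "(\<lambda>a. \<lambda>i\<in>{1..n}. f i (a i)) ` A = (\<lambda>b. \<lambda>i\<in>{1..n}. b (g i)) ` X"
    using assms(3) unfolding isomorphic_def by blast
  have injA: "inj_on (\<lambda>a. \<lambda>i\<in>{1..n}. f i (a i)) A"
  proof (rule inj_onI)
    fix a b assume ab: "a \<in> A" "b \<in> A" "(\<lambda>i\<in>{1..n}. f i (a i)) = (\<lambda>i\<in>{1..n}. f i (b i))"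
    show "a = b"
    proof (rule seqs_eqI[OF subsetD[OF AX(1) ab(1)] subsetD[OF AX(1) ab(2)]])
      fix k assume k: "k \<in> {1..n}"
      have "f k (a k) = f k (b k)" using fun_cong[OF ab(3), of k] k by simp
      moreover have "inj (f k)" using f k permutes_inj by blast
      ultimately show "a k = b k" by (simp add: inj_eq)
    qed
  qed
  have injX: "inj_on (\<lambda>b. \<lambda>i\<in>{1..n}. b (g i)) X"
  proof (rule inj_onI)
    fix a b assume ab: "a \<in> X" "b \<in> X" "(\<lambda>i\<in>{1..n}. a (g i)) = (\<lambda>i\<in>{1..n}. b (g i))"
    show "a = b"
    proof (rule seqs_eqI[OF subsetD[OF AX(2) ab(1)] subsetD[OF AX(2) ab(2)]])
      fix k assume "k \<in> {1..n}"
      then obtain l where l: "l \<in> {1..n}" "k = g l" using permutes_image[OF g] by blast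
      show "a k = b k" using fun_cong[OF ab(3), of l] l by simp
    qed
  qed
  show ?thesis using card_image[OF injA] card_image[OF injX] unfolding eq by simp
qed

lemma permutes_onto_initial:
  assumes "T \<subseteq> {1..n::nat}"
  obtains g where "g permutes {1..n}" "g ` T = {1..card T}"
proof -
  have fin: "finite T" using assms finite_subset by blast
  have le: "card T \<le> n" using card_mono[OF _ assms] by simp
  obtain f1 where f1: "bij_betw f1 T {1..card T}"
    using finite_same_card_bij[OF fin, of "{1..card T}"] by auto
  have "card ({1..n} - T) = card ({1..n} - {1..card T})"
    using assms fin le by (simp add: card_Diff_subset)
  then obtain f2 where f2: "bij_betw f2 ({1..n} - T) ({1..n} - {1..card T})"
    using finite_same_card_bij[of "{1..n} - T" "{1..n} - {1..card T}"] by auto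
  define g where "g k = (if k \<in> T then f1 k else if k \<in> {1..n} then f2 k else k)" for k
  have g1: "bij_betw g T {1..card T}"
    using f1 by (rule bij_betw_cong[THEN iffD1, rotated]) (simp add: g_def)
  have g2: "bij_betw g ({1..n} - T) ({1..n} - {1..card T})"
    using f2 by (rule bij_betw_cong[THEN iffD1, rotated]) (simp add: g_def)
  have "bij_betw g (T \<union> ({1..n} - T)) ({1..card T} \<union> ({1..n} - {1..card T}))"
    using g1 g2 by (rule bij_betw_combine) blast
  moreover have "T \<union> ({1..n} - T) = {1..n}" "{1..card T} \<union> ({1..n} - {1..card T}) = {1..n}"
    using assms le by auto
  ultimately have "g permutes {1..n}"
    using assms by (intro bij_imp_permutes) (auto simp: g_def)
  then show ?thesis using bij_betw_imp_surj_on[OF g1] by (rule that)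
qed

section \<open>From sequences to sets\<close>

context sequence_space begin

text \<open>A copy of the Frankl family of sequences in which the coordinates \<open>T\<close> and
  the distinguished values \<open>c\<close> are arbitrary, as is needed when compressions are
  undone.\<close>

definition pattern :: "nat set \<Rightarrow> (nat \<Rightarrow> nat) \<Rightarrow> nat \<Rightarrow> (nat \<Rightarrow> nat) set" where
  "pattern T c r = {a \<in> seqs m n. t + r \<le> card {k \<in> T. a k = c k}}"

definition extremal :: "(nat \<Rightarrow> nat) set \<Rightarrow> bool" where
  "extremal X \<longleftrightarrow> (\<exists>T c r. T \<subseteq> {1..n} \<and> card T = t + 2 * r \<and> (r = 0 \<or> r = 1 \<and> m = t + 1) \<and>
     (\<forall>k\<in>T. c k \<in> {1..m}) \<and> X = pattern T c r)"

lemma sigma_ground: "sigma n a \<subseteq> {1..n}"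
  unfolding sigma_def by blast

lemma card_sigma:
  assumes A: "A \<subseteq> Pow {1..n}"
  shows "card {a \<in> seqs m n. sigma n a \<in> A} = wt A"
proof -
  have one: "card {a \<in> seqs m n. sigma n a = E} = (m - 1) ^ (n - card E)" if E: "E \<subseteq> {1..n}" for E
  proof -
    have "{a \<in> seqs m n. sigma n a = E} = (\<Pi>\<^sub>E i\<in>{1..n}. if i \<in> E then {1} else {2..m})"
    proof (intro equalityI subsetI)
      fix a assume a: "a \<in> {a \<in> seqs m n. sigma n a = E}"
      then have "i \<in> E \<longleftrightarrow> a i = 1" if "i \<in> {1..n}" for i using that by (auto simp: sigma_def)
      moreover have "a i \<in> {1..m}" if "i \<in> {1..n}" for i using a that seqs_range by blast
      ultimately have "a i \<in> (if i \<in> E then {1} else {2..m})" if "i \<in> {1..n}" for i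
        using that by fastforce
      then show "a \<in> (\<Pi>\<^sub>E i\<in>{1..n}. if i \<in> E then {1} else {2..m})"
        using a unfolding seqs_def PiE_iff by blast
    next
      fix a assume a: "a \<in> (\<Pi>\<^sub>E i\<in>{1..n}. if i \<in> E then {1} else {2..m})"
      then have *: "a i \<in> (if i \<in> E then {1} else {2..m})" if "i \<in> {1..n}" for i
        using that by (rule PiE_mem)
      have "a i \<in> {1..m}" if "i \<in> {1..n}" for i
        using *[OF that] m t by (auto split: if_splits)
      then have "a \<in> seqs m n" using a unfolding seqs_def PiE_iff by blast
      moreover have "i \<in> E \<longleftrightarrow> a i = 1" if "i \<in> {1..n}" for i
        using *[OF that] by (auto split: if_splits)
      then have "sigma n a = E" using E unfolding sigma_def by blast
      ultimately show "a \<in> {a \<in> seqs m n. sigma n a = E}" by simp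
    qed
    also have "card \<dots> = (\<Prod>i\<in>{1..n}. if i \<in> E then 1 else m - 1)"
      by (subst card_PiE) (auto intro!: prod.cong)
    also have "\<dots> = (m - 1) ^ card {i \<in> {1..n}. i \<notin> E}"
      by (subst prod.If_cases) (auto simp: Collect_neg_eq[symmetric] Int_def)
    also have "{i \<in> {1..n}. i \<notin> E} = {1..n} - E" by blast
    also have "card \<dots> = n - card E"
      using card_Diff_subset[OF finite_ground[OF E] E] by simp
    finally show ?thesis .
  qed
  have "{a \<in> seqs m n. sigma n a \<in> A} = (\<Union>E\<in>A. {a \<in> seqs m n. sigma n a = E})" by blast
  also have "card \<dots> = (\<Sum>E\<in>A. card {a \<in> seqs m n. sigma n a = E})"
    using finite_seqs finite_family[OF A] by (intro card_UN_disjoint) auto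
  also have "\<dots> = wt A"
    unfolding wt_def using A one by (intro sum.cong) auto
  finally show ?thesis .
qed

lemma sigma_standard:
  assumes "standard S"
  shows "extremal {a \<in> seqs m n. sigma n a \<in> S}"
proof -
  obtain T r where T: "T \<subseteq> {1..n}" "card T = t + 2 * r" "r = 0 \<or> r = 1 \<and> m = t + 1" "S = slab T r"
    using assms unfolding standard_def by blast
  have "sigma n a \<inter> T = {k \<in> T. a k = 1}" for a
    using T(1) unfolding sigma_def by blast
  then have "{a \<in> seqs m n. sigma n a \<in> S} = pattern T (\<lambda>_. 1) r"
    unfolding T(4) slab_def pattern_def using sigma_ground by simp
  then show ?thesis
    unfolding extremal_def using T m by (intro exI[of _ T] exI[of _ "\<lambda>_. 1"] exI[of _ r]) auto
qed

text \<open>The images under \<open>sigma n\<close> form a cross \<open>t\<close>-intersecting pair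
  of set families, and their weights bound the cardinalities. In the case of equality both
  \<open>A\<close> and \<open>B\<close> must be the full preimages of these images.\<close>

lemma compressed_bound:
  assumes AB: "A \<subseteq> seqs m n" "B \<subseteq> seqs m n" and cr: "cross_intersecting t n A B"
    and closed: "\<And>b i. b \<in> B \<Longrightarrow> i \<in> {1..n} \<Longrightarrow> b(i := 1) \<in> B"
  shows "card A * card B \<le> (m ^ (n - t))\<^sup>2 \<and>
    (card A * card B = (m ^ (n - t))\<^sup>2 \<longrightarrow> A = B \<and> extremal A)"
proof -
  have many: "(\<lambda>k. if k \<in> J then 1 else b k) \<in> B" if "finite J" "J \<subseteq> {1..n}" "b \<in> B" for J b
    using that
  proof (induction J rule: finite_induct)
    case empty
    then show ?case by simp
  next
    case (insert j J)
    have "(\<lambda>k. if k \<in> insert j J then 1 else b k) = (\<lambda>k. if k \<in> J then 1 else b k)(j := 1)"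
      by auto
    then show ?case using insert closed by simp
  qed
  let ?A = "sigma n ` A" and ?B = "sigma n ` B"
  have sub: "?A \<subseteq> Pow {1..n}" "?B \<subseteq> Pow {1..n}" using sigma_ground by blast+
  have "t \<le> card (sigma n a \<inter> sigma n b)" if "a \<in> A" "b \<in> B" for a b
  proof -
    \<comment> \<open>Resetting \<open>b\<close> to \<open>1\<close> wherever \<open>a\<close>
      differs from \<open>1\<close> leaves agreement with \<open>a\<close> only at the coordinates
      where both original sequences are \<open>1\<close>.\<close>
    define J where "J = {k \<in> {1..n}. a k \<noteq> 1}"
    have J: "J \<subseteq> {1..n}" unfolding J_def by blast
    then have "finite J" by (rule finite_ground)
    have "t \<le> card {k \<in> {1..n}. a k = (if k \<in> J then 1 else b k)}"
      using bspec[OF bspec[OF cr[unfolded cross_intersecting_def] that(1)] many[OF \<open>finite J\<close> J that(2)]] .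
    also have "{k \<in> {1..n}. a k = (if k \<in> J then 1 else b k)} = sigma n a \<inter> sigma n b"
      unfolding sigma_def J_def by auto
    finally show ?thesis .
  qed
  then have cross: "cross ?A ?B" unfolding cross_def using sub by blast
  define A' B' where "A' = {a \<in> seqs m n. sigma n a \<in> ?A}" and "B' = {a \<in> seqs m n. sigma n a \<in> ?B}"
  have fin: "finite A'" "finite B'" using finite_seqs by (simp_all add: A'_def B'_def)
  have A': "A \<subseteq> A'" "card A' = wt ?A" and B': "B \<subseteq> B'" "card B' = wt ?B"
    using AB card_sigma sub by (auto simp: A'_def B'_def)
  have le: "card A \<le> wt ?A" "card B \<le> wt ?B"
    using card_mono[OF fin(1) A'(1)] card_mono[OF fin(2) B'(1)] A' B' by simp_all
  have prod_le: "card A * card B \<le> wt ?A * wt ?B" using le by (rule mult_le_mono)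
  also note cross_wt(1)[OF cross]
  finally have bound: "card A * card B \<le> (m ^ (n - t))\<^sup>2" .
  have "A = B \<and> extremal A" if eq: "card A * card B = (m ^ (n - t))\<^sup>2"
  proof -
    have wt_eq: "wt ?A * wt ?B = (m ^ (n - t))\<^sup>2" using prod_le cross_wt(1)[OF cross] eq by simp
    note char = cross_wt(2)[OF cross wt_eq]
    have "0 < (m ^ (n - t))\<^sup>2" using m by simp
    then have pos: "0 < card A" "0 < card B" using eq by (auto intro: gr0I)
    have "card A = wt ?A"
    proof (rule ccontr)
      assume "card A \<noteq> wt ?A"
      then have "card A * card B < wt ?A * wt ?B"
        using le pos by (intro mult_less_le_imp_less) auto
      then show False using eq wt_eq by simp
    qed
    then have AA: "A = A'" using card_subset_eq[OF fin(1) A'(1)] A'(2) by simp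
    have "card B = wt ?B"
    proof (rule ccontr)
      assume "card B \<noteq> wt ?B"
      then have "card A * card B < wt ?A * wt ?B"
        using le pos by (intro mult_le_less_imp_less) auto
      then show False using eq wt_eq by simp
    qed
    then have BB: "B = B'" using card_subset_eq[OF fin(2) B'(1)] B'(2) by simp
    have "A' = B'" using char by (simp add: A'_def B'_def)
    moreover have "extremal A'" unfolding A'_def by (rule sigma_standard[OF conjunct2[OF char]])
    ultimately show ?thesis using AA BB by simp
  qed
  then show ?thesis using bound by blast
qed

section \<open>Changing one value in one coordinate, and reversing it\<close>

context
  fixes i v :: nat
  assumes iv: "i \<in> {1..n}" "v \<in> {1..m}" "1 < v"
begin

lemma value_not_1: "v \<noteq> 1"
  using iv(3) by simp

interpretation compression "\<lambda>a. a(i := Transposition.transpose 1 v (a i))" "{a. a i = v}"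
  "\<lambda>a b. card {k \<in> {1..n}. a k = b k}"
  using compression_value[OF iv(1) value_not_1] .

lemma swap_value_seqs:
  assumes "a \<in> seqs m n"
  shows "a(i := Transposition.transpose 1 v (a i)) \<in> seqs m n"
proof (rule seqs_update[OF assms iv(1)])
  show "Transposition.transpose 1 v (a i) \<in> {1..m}"
    using seqs_range[OF assms iv(1)] iv(2) by (auto simp: Transposition.transpose_def)
qed

lemma compress_seqs:
  assumes "A \<subseteq> seqs m n"
  shows "compress i v A \<subseteq> seqs m n"
proof -
  have "(\<lambda>a. a(i := Transposition.transpose 1 v (a i))) ` seqs m n \<subseteq> seqs m n"
  proof
    fix b assume "b \<in> (\<lambda>a. a(i := Transposition.transpose 1 v (a i))) ` seqs m n"
    then obtain a where a: "a \<in> seqs m n" "b = a(i := Transposition.transpose 1 v (a i))" by (rule imageE)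
    show "b \<in> seqs m n" unfolding a(2) by (rule swap_value_seqs[OF a(1)])
  qed
  from comp_subset[OF assms this] show ?thesis unfolding compress_def .
qed

lemma compress_cross:
  assumes "cross_intersecting t n A B"
  shows "cross_intersecting t n (compress i v A) (compress i v B)"
proof -
  have "t \<le> card {k \<in> {1..n}. a k = b k}" if "a \<in> A" "b \<in> B" for a b
    using assms that unfolding cross_intersecting_def by blast
  from comp_cross[of A B t, OF this] show ?thesis
    unfolding cross_intersecting_def compress_def by blast
qed

lemma card_compress: "card (compress i v A) = card A"
  unfolding compress_def by (rule card_comp)

lemma compress_fixed:
  assumes "compress i v A = A" "a \<in> A" "a i = v"
  shows "a(i := 1) \<in> A"
proof -
  have "a \<in> comp A" using assms(1,2) unfolding compress_def by simp
  then have "a(i := Transposition.transpose 1 v (a i)) \<in> A" using comp_dom[of a A] assms(3) by blast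
  then show ?thesis using assms(3) by simp
qed

lemma compress_decreases:
  assumes "A \<subseteq> seqs m n"
  shows "(\<Sum>a\<in>compress i v A. \<Sum>k\<in>{1..n}. a k) \<le> (\<Sum>a\<in>A. \<Sum>k\<in>{1..n}. a k)"
    and "compress i v A \<noteq> A \<Longrightarrow>
      (\<Sum>a\<in>compress i v A. \<Sum>k\<in>{1..n}. a k) < (\<Sum>a\<in>A. \<Sum>k\<in>{1..n}. a k)"
proof -
  have less: "(\<Sum>k\<in>{1..n}. (a(i := Transposition.transpose 1 v (a i))) k) < (\<Sum>k\<in>{1..n}. a k)"
    if "a \<in> A" "a \<in> {a. a i = v}" for a
  proof (rule sum_strict_mono_ex1)
    show "\<forall>k\<in>{1..n}. (a(i := Transposition.transpose 1 v (a i))) k \<le> a k"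
      using that(2) iv(3) by auto
    show "\<exists>k\<in>{1..n}. (a(i := Transposition.transpose 1 v (a i))) k < a k"
      using that(2) iv by (intro bexI[of _ i]) auto
  qed simp
  have fin: "finite A" using assms finite_seqs by (rule finite_subset)
  show "(\<Sum>a\<in>compress i v A. \<Sum>k\<in>{1..n}. a k) \<le> (\<Sum>a\<in>A. \<Sum>k\<in>{1..n}. a k)"
    unfolding compress_def by (rule comp_decreases(1)[where h = "\<lambda>a. \<Sum>k\<in>{1..n}. a k", OF fin less])
  show "compress i v A \<noteq> A \<Longrightarrow>
      (\<Sum>a\<in>compress i v A. \<Sum>k\<in>{1..n}. a k) < (\<Sum>a\<in>A. \<Sum>k\<in>{1..n}. a k)"
    unfolding compress_def by (rule comp_decreases(2)[where h = "\<lambda>a. \<Sum>k\<in>{1..n}. a k", OF fin less])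
qed

lemma swap_value_pattern:
  "(\<lambda>a. a(i := Transposition.transpose 1 v (a i))) ` pattern T c r =
    pattern T (c(i := Transposition.transpose 1 v (c i))) r"
proof -
  let ?f = "\<lambda>a :: nat \<Rightarrow> nat. a(i := Transposition.transpose 1 v (a i))"
  have sub: "?f a \<in> pattern T (?f c) r" if "a \<in> pattern T c r" for a c
  proof -
    have "{k \<in> T. ?f a k = ?f c k} = {k \<in> T. a k = c k}"
      by (auto simp: Transposition.transpose_def)
    then show ?thesis using that swap_value_seqs unfolding pattern_def by simp
  qed
  show ?thesis
  proof (intro equalityI subsetI)
    fix a assume "a \<in> pattern T (?f c) r"
    then have "?f a \<in> pattern T c r" using sub[of a "?f c"] by simp
    then have "?f (?f a) \<in> ?f ` pattern T c r" by (rule imageI)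
    then show "a \<in> ?f ` pattern T c r" by (simp only: invol)
  qed (use sub in auto)
qed

text \<open>The counterpart of \<open>shift_reverse\<close> for sequences, again through
  \<open>comp_reverse\<close>; here \<open>T\<close> stays and only the value of \<open>c\<close> at
  \<open>i\<close> may change.\<close>

lemma compress_reverse:
  assumes cr: "cross_intersecting t n A B"
    and T: "T \<subseteq> {1..n}" "card T = t + 2 * r" "r \<le> 1" "\<forall>k\<in>T. c k \<in> {1..m}"
    and AB: "compress i v A = pattern T c r" "compress i v B = pattern T c r"
  obtains c' where "\<forall>k\<in>T. c' k \<in> {1..m}" "A = pattern T c' r" "B = pattern T c' r"
proof -
  let ?f = "\<lambda>a :: nat \<Rightarrow> nat. a(i := Transposition.transpose 1 v (a i))"
  let ?X = "pattern T c r"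
  let ?P = "{g \<in> {a. a i = v}. g \<notin> ?X \<and> ?f g \<in> ?X}"
  define G where "G g = {k \<in> T. g k = c k}" for g
  have fin: "finite T" "finite (G g)" for g using finite_ground[OF T(1)] by (simp_all add: G_def)
  have in_X: "g \<in> ?X \<longleftrightarrow> g \<in> seqs m n \<and> t + r \<le> card (G g)" for g
    by (simp add: pattern_def G_def)
  have f_eq: "?f g = g(i := 1)" if "g i = v" for g using that by simp
  have P: "g i = v" "i \<in> T" "c i = 1" "g \<in> seqs m n" "card (G g) = t + r - 1" "i \<notin> G g" if g: "g \<in> ?P" for g
  proof -
    show gi: "g i = v" using g by simp
    have fX: "?f g \<in> ?X" and gX: "g \<notin> ?X" using g by blast+
    have "?f g \<in> seqs m n" using fX unfolding in_X by (rule conjunct1)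
    then have "?f (?f g) \<in> seqs m n" by (rule swap_value_seqs)
    then show gs: "g \<in> seqs m n" by (simp only: invol)
    have ge: "t + r \<le> card (G (g(i := 1)))"
    proof -
      have "g(i := 1) \<in> ?X" using fX unfolding f_eq[of g, OF gi] .
      then show ?thesis using in_X by blast
    qed
    have lt: "card (G g) < t + r" using gX in_X gs by simp
    \<comment> \<open>Only the coordinate \<open>i\<close> can produce a new agreement with
      \<open>c\<close>, so it lies in \<open>T\<close> and carries the value \<open>1\<close>
      there.\<close>
    have "\<not> G (g(i := 1)) \<subseteq> G g" using card_mono[OF fin(2), of "G (g(i := 1))" g] ge lt by linarith
    then have "i \<in> T \<and> c i = 1" unfolding G_def by (auto split: if_splits)
    then show ci: "i \<in> T" "c i = 1" by blast+
    show iG: "i \<notin> G g" using gi ci value_not_1 by (simp add: G_def)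
    have "G (g(i := 1)) = insert i (G g)" using ci unfolding G_def by auto
    then have "card (G (g(i := 1))) = Suc (card (G g))" using iG fin(2) by simp
    then show "card (G g) = t + r - 1" using ge lt by linarith
  qed
  have nbr: "\<exists>h\<in>?P. card {k \<in> {1..n}. ?f g k = h k} < t \<and> card {k \<in> {1..n}. ?f g' k = h k} < t"
    if g: "g \<in> ?P" "g' \<in> ?P" for g g'
  proof -
    note Pg = P[OF g(1)] and Pg' = P[OF g(2)]
    define Q where "Q = T - {i}"
    have Q: "finite Q" "card Q = t + 2 * r - 1" using fin Pg(2) T(2) by (simp_all add: Q_def)
    have GQ: "G g \<subseteq> Q" "G g' \<subseteq> Q" using Pg(6) Pg'(6) by (auto simp: Q_def G_def)
    have "card (G g) + card (G g') = card (G g \<union> G g') + card (G g \<inter> G g')"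
      using fin by (intro card_Un_Int)
    moreover have "card (G g \<union> G g') \<le> card Q"
      using Q GQ by (intro card_mono) auto
    ultimately have "r \<le> card (G g \<inter> G g')" using Pg(5) Pg'(5) Q(2) t T(3) by linarith
    then obtain R where R: "R \<subseteq> G g \<inter> G g'" "card R = r" "finite R"
      by (rule obtain_subset_with_card_n)
    have RQ: "R \<subseteq> Q" using R(1) GQ by blast
    \<comment> \<open>Agreements also count outside \<open>T\<close>, so the neighbour needs a value
      different from both sequences there; this takes three values.\<close>
    have "\<exists>x\<in>{1..m}. x \<noteq> g k \<and> x \<noteq> g' k" for k
    proof -
      have "\<not> {1..m} \<subseteq> {g k, g' k}"
      proof
        assume "{1..m} \<subseteq> {g k, g' k}"
        then have "card {1..m} \<le> card {g k, g' k}" by (intro card_mono) simp_all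
        also have "\<dots> \<le> 2" by (simp add: card_insert_if)
        finally show False using m t by simp
      qed
      then show ?thesis by blast
    qed
    then obtain w where w: "\<And>k. w k \<in> {1..m} \<and> w k \<noteq> g k \<and> w k \<noteq> g' k" by metis
    \<comment> \<open>The neighbour follows \<open>c\<close> on \<open>Q - R\<close> and avoids
      \<open>g\<close> and \<open>g'\<close> elsewhere. On \<open>R\<close> both agree with
      \<open>c\<close>, so \<open>h\<close> disagrees with \<open>c\<close> there. At
      \<open>i\<close> it has the value \<open>v\<close>, whereas the swapped sequences have
      \<open>1\<close>.\<close>
    define h where "h = (\<lambda>k\<in>{1..n}. if k = i then v else if k \<in> Q - R then c k else w k)"
    have hs: "h \<in> seqs m n"
      unfolding h_def using iv(2) T(4) w by (intro restrict_seqs) (auto simp: Q_def)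
    have hi: "h i = v" using iv(1) by (simp add: h_def)
    have h_c: "h k = c k" if "k \<in> Q - R" for k
      using that T(1) unfolding h_def Q_def by auto
    have h_w: "h k = w k" if "k \<in> {1..n}" "k \<notin> Q - R" "k \<noteq> i" for k
      using that unfolding h_def by auto
    have "G h = Q - R"
    proof (intro equalityI subsetI)
      fix k assume k: "k \<in> G h"
      show "k \<in> Q - R"
      proof (rule ccontr)
        assume nk: "k \<notin> Q - R"
        have kT: "k \<in> T" "h k = c k" using k by (auto simp: G_def)
        then have "k \<noteq> i" using hi Pg(3) value_not_1 by auto
        then have "k \<in> R" using nk kT(1) by (simp add: Q_def)
        then have "g k = c k" using R(1) by (auto simp: G_def)
        then show False using h_w[OF _ nk \<open>k \<noteq> i\<close>] w[of k] kT T(1) by auto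
      qed
    qed (use h_c in \<open>auto simp: G_def Q_def\<close>)
    then have hG: "card (G h) = t + r - 1"
      using card_Diff_subset[OF R(3) RQ] Q(2) R(2) by simp
    have iG: "i \<notin> G h" using hi Pg(3) value_not_1 by (simp add: G_def)
    have "G (h(i := 1)) = insert i (G h)" using Pg(2,3) unfolding G_def by auto
    then have "card (G (h(i := 1))) = Suc (card (G h))" using iG fin(2) by simp
    then have "t + r \<le> card (G (?f h))" using hG t f_eq[of h, OF hi] by simp
    then have "?f h \<in> ?X" using swap_value_seqs[OF hs] in_X by blast
    moreover have "\<not> t + r \<le> card (G h)" using hG t by linarith
    then have "h \<notin> ?X" unfolding in_X by blast
    ultimately have hP: "h \<in> ?P" using hi by simp
    have "card {k \<in> {1..n}. ?f g k = h k} < t"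
      if "g \<in> ?P" "R \<subseteq> G g" "\<And>k. w k \<noteq> g k" for g
    proof -
      have "{k \<in> {1..n}. ?f g k = h k} \<subseteq> G g - R"
      proof
        fix k assume "k \<in> {k \<in> {1..n}. ?f g k = h k}"
        then have k: "k \<in> {1..n}" "(g(i := 1)) k = h k"
          unfolding f_eq[of g, OF P(1)[OF that(1)]] by blast+
        then have "k \<noteq> i" using hi value_not_1 by auto
        then have gh: "g k = h k" using k by simp
        then have "k \<in> Q - R" using h_w[OF k(1) _ \<open>k \<noteq> i\<close>] that(3)[of k] by metis
        then show "k \<in> G g - R" using gh h_c by (auto simp: G_def Q_def)
      qed
      then have "card {k \<in> {1..n}. ?f g k = h k} \<le> card (G g - R)" using fin by (intro card_mono) auto
      also have "\<dots> = t - 1" using card_Diff_subset[OF R(3) that(2)] P(5)[OF that(1)] R(2) by simp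
      finally show ?thesis using t by linarith
    qed
    then have "card {k \<in> {1..n}. ?f g k = h k} < t" "card {k \<in> {1..n}. ?f g' k = h k} < t"
      using g R(1) w by blast+
    then show ?thesis using hP by blast
  qed
  have cr': "\<And>x y. x \<in> A \<Longrightarrow> y \<in> B \<Longrightarrow> t \<le> card {k \<in> {1..n}. x k = y k}"
    using cr unfolding cross_intersecting_def by blast
  from comp_reverse[of A B t ?X, OF cr' AB[unfolded compress_def] nbr]
  consider "A = ?X" "B = ?X" | "A = ?f ` ?X" "B = ?f ` ?X"
    by blast
  then show ?thesis
  proof cases
    case 1
    then show ?thesis using that T by blast
  next
    case 2
    have "\<forall>k\<in>T. ?f c k \<in> {1..m}"
      using T(4) iv(2) by (auto simp: Transposition.transpose_def)
    then show ?thesis using that[of "?f c"] 2 unfolding swap_value_pattern by blast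
  qed
qed

end

text \<open>Induction on the sum of all entries. Compression preserves both cardinalities, so the
  bound carries over at once, and \<open>compress_reverse\<close> brings the equality case
  back.\<close>

theorem cross_intersecting_bound:
  assumes "A \<subseteq> seqs m n" "B \<subseteq> seqs m n" "cross_intersecting t n A B"
  shows "card A * card B \<le> (m ^ (n - t))\<^sup>2 \<and>
    (card A * card B = (m ^ (n - t))\<^sup>2 \<longrightarrow> A = B \<and> extremal A)"
  using assms
proof (induction "(\<Sum>a\<in>A. \<Sum>k\<in>{1..n}. a k) + (\<Sum>a\<in>B. \<Sum>k\<in>{1..n}. a k)" arbitrary: A B rule: less_induct)
  case (less A B)
  show ?case
  proof (cases "\<exists>i v. i \<in> {1..n} \<and> v \<in> {1..m} \<and> 1 < v \<and> (compress i v A \<noteq> A \<or> compress i v B \<noteq> B)")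
    case True
    then obtain i v where iv: "i \<in> {1..n}" "v \<in> {1..m}" "1 < v" "compress i v A \<noteq> A \<or> compress i v B \<noteq> B"
      by blast
    let ?A = "compress i v A" and ?B = "compress i v B"
    note dec = compress_decreases[OF iv(1-3)]
    have "(\<Sum>a\<in>?A. \<Sum>k\<in>{1..n}. a k) + (\<Sum>a\<in>?B. \<Sum>k\<in>{1..n}. a k)
        < (\<Sum>a\<in>A. \<Sum>k\<in>{1..n}. a k) + (\<Sum>a\<in>B. \<Sum>k\<in>{1..n}. a k)"
      using dec[OF less.prems(1)] dec[OF less.prems(2)] iv(4) by linarith
    from less.hyps[OF this compress_seqs[OF iv(1-3) less.prems(1)] compress_seqs[OF iv(1-3) less.prems(2)]
        compress_cross[OF iv(1-3) less.prems(3)]]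
    have IH: "card A * card B \<le> (m ^ (n - t))\<^sup>2"
      "card A * card B = (m ^ (n - t))\<^sup>2 \<longrightarrow> ?A = ?B \<and> extremal ?A"
      unfolding card_compress[OF iv(1-3)] by blast+
    have "A = B \<and> extremal A" if same: "?A = ?B" and ext: "extremal ?A"
    proof -
      obtain T c r where T: "T \<subseteq> {1..n}" "card T = t + 2 * r" "r = 0 \<or> r = 1 \<and> m = t + 1"
        "\<forall>k\<in>T. c k \<in> {1..m}" "?A = pattern T c r"
        using ext unfolding extremal_def by blast
      then have "r \<le> 1" "?B = pattern T c r" using same by auto
      from compress_reverse[OF iv(1-3) less.prems(3) T(1,2) this(1) T(4,5) this(2)]
      obtain c' where "\<forall>k\<in>T. c' k \<in> {1..m}" "A = pattern T c' r" "B = pattern T c' r" .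
      then show ?thesis using T(1-3) unfolding extremal_def by blast
    qed
    then show ?thesis using IH by blast
  next
    case False
    \<comment> \<open>If \<open>b i\<close> differs from \<open>1\<close>, use that the compression
      with \<open>v = b i\<close> fixes \<open>B\<close>.\<close>
    have "b(i := 1) \<in> B" if "b \<in> B" "i \<in> {1..n}" for b i
    proof (cases "b i = 1")
      case True
      then show ?thesis using that by (simp add: fun_upd_idem)
    next
      case b: False
      have v: "b i \<in> {1..m}" using less.prems(2) that seqs_range by blast
      then have "1 < b i" using b by simp
      then show ?thesis using compress_fixed[OF that(2) v _ _ that(1) refl] False that(2) v by blast
    qed
    then show ?thesis by (rule compressed_bound[OF less.prems])
  qed
qed

section \<open>Extremal families up to isomorphism\<close>

lemma card_frankl_seqs:
  assumes "t + 2 * r \<le> n" "r = 0 \<or> r = 1 \<and> m = t + 1"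
  shows "card (frankl_seqs m r t n) = m ^ (n - t)"
proof -
  have "slab {1..t + 2 * r} r \<subseteq> Pow {1..n}" unfolding slab_def by blast
  from card_sigma[OF this] have "card (frankl_seqs m r t n) = wt (slab {1..t + 2 * r} r)"
    unfolding frankl_seqs_def frankl_family_def slab_def .
  moreover have "standard (slab {1..t + 2 * r} r)"
    unfolding standard_def using assms by (intro exI[of _ "{1..t + 2 * r}"] exI[of _ r]) auto
  ultimately show ?thesis using wt_standard by simp
qed

text \<open>The permutations of values exchange \<open>c k\<close> with \<open>1\<close> on
  \<open>T\<close>, and the permutation of coordinates carries \<open>T\<close> onto
  \<open>{1..t + 2 * r}\<close>. Both images required by \<open>isomorphic\<close> then equal the
  family \<open>Z\<close> normalised to value \<open>1\<close> but still located on
  \<open>T\<close>.\<close>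

lemma isomorphic_pattern:
  assumes T: "T \<subseteq> {1..n}" "card T = t + 2 * r" and c: "\<forall>k\<in>T. c k \<in> {1..m}"
  shows "isomorphic m n (pattern T c r) (frankl_seqs m r t n)"
proof -
  obtain g where g: "g permutes {1..n}" "g ` T = {1..t + 2 * r}"
    using permutes_onto_initial[OF T(1)] T(2) by metis
  define f where "f k = (if k \<in> T then Transposition.transpose (c k) 1 else id)" for k
  have f: "f k permutes {1..m}" for k
    unfolding f_def using c m t by (auto intro!: permutes_swap_id permutes_id)
  have ff: "f k (f k x) = x" for k x by (simp add: f_def)
  define Z where "Z = {z \<in> seqs m n. t + r \<le> card {k \<in> T. z k = 1}}"
  have Z_iff: "z \<in> Z \<longleftrightarrow> t + r \<le> card {k \<in> T. z k = 1}" if "z \<in> seqs m n" for z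
    using that by (simp add: Z_def)
  let ?F = "\<lambda>a. \<lambda>k\<in>{1..n}. f k (a k)"
  let ?G = "\<lambda>b. \<lambda>k\<in>{1..n}. b (g k)"
  have F_seqs: "?F a \<in> seqs m n" if "a \<in> seqs m n" for a
    by (rule restrict_seqs) (simp only: permutes_in_image[OF f] seqs_range[OF that])
  have FT: "f k x = 1 \<longleftrightarrow> x = c k" if "k \<in> T" for k x
    using that unfolding f_def by (auto simp: Transposition.transpose_def)
  have "?F ` pattern T c r = Z"
  proof (intro equalityI subsetI)
    fix z assume "z \<in> ?F ` pattern T c r"
    then obtain a where a: "a \<in> seqs m n" "t + r \<le> card {k \<in> T. a k = c k}" "z = ?F a"
      unfolding pattern_def by blast
    have "{k \<in> T. z k = 1} = {k \<in> T. a k = c k}"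
      using a(3) FT T(1) by auto
    then show "z \<in> Z" using a F_seqs unfolding Z_def by simp
  next
    fix z assume z: "z \<in> Z"
    then have zs: "z \<in> seqs m n" by (simp add: Z_def)
    have "{k \<in> T. ?F z k = c k} = {k \<in> T. z k = 1}"
    proof (rule Collect_cong, rule conj_cong[OF refl])
      fix k assume k: "k \<in> T"
      then have "?F z k = f k (z k)" using T(1) by auto
      then show "?F z k = c k \<longleftrightarrow> z k = 1" using FT[OF k, of "f k (z k)"] ff by metis
    qed
    then have "?F z \<in> pattern T c r" using z F_seqs[OF zs] unfolding pattern_def Z_def by simp
    then have "?F (?F z) \<in> ?F ` pattern T c r" by (rule imageI)
    moreover have "?F (?F z) = z"
      using F_seqs[OF F_seqs[OF zs]] zs by (rule seqs_eqI) (simp add: ff)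
    ultimately show "z \<in> ?F ` pattern T c r" by (simp only:)
  qed
  moreover have "?G ` frankl_seqs m r t n = Z"
  proof -
    have gin: "g k \<in> {1..n}" "inv g k \<in> {1..n}" if "k \<in> {1..n}" for k
      using that permutes_in_image[OF g(1)] permutes_in_image[OF permutes_inv[OF g(1)]] by blast+
    have ginv: "g (inv g k) = k" "inv g (g k) = k" for k
      using permutes_inverses[OF g(1)] by simp_all
    have G_seqs: "?G b \<in> seqs m n" if "b \<in> seqs m n" for b
      using seqs_range[OF that gin(1)] by (rule restrict_seqs)
    have cards: "card {k \<in> T. ?G b k = 1} = card (sigma n b \<inter> {1..t + 2 * r})" for b
    proof -
      have "g ` {k \<in> T. ?G b k = 1} = sigma n b \<inter> {1..t + 2 * r}"
        unfolding sigma_def g(2)[symmetric] using T(1) gin(1) by force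
      moreover have "inj_on g {k \<in> T. ?G b k = 1}"
        using permutes_inj[OF g(1)] inj_on_subset by blast
      ultimately show ?thesis using card_image by metis
    qed
    have G_iff: "?G b \<in> Z \<longleftrightarrow> b \<in> frankl_seqs m r t n" if "b \<in> seqs m n" for b
    proof -
      have "?G b \<in> Z \<longleftrightarrow> t + r \<le> card {k \<in> T. ?G b k = 1}"
        by (rule Z_iff[OF G_seqs[OF that]])
      also have "\<dots> \<longleftrightarrow> b \<in> frankl_seqs m r t n"
        unfolding cards frankl_seqs_def frankl_family_def using that sigma_ground[of b] by blast
      finally show ?thesis .
    qed
    show ?thesis
    proof (intro equalityI subsetI)
      fix z assume "z \<in> ?G ` frankl_seqs m r t n"
      then obtain b where b: "b \<in> frankl_seqs m r t n" "z = ?G b" by blast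
      then have "b \<in> seqs m n" by (simp add: frankl_seqs_def)
      then show "z \<in> Z" using G_iff b by blast
    next
      fix z assume z: "z \<in> Z"
      then have zs: "z \<in> seqs m n" by (simp add: Z_def)
      define b where "b = (\<lambda>k\<in>{1..n}. z (inv g k))"
      have b: "b \<in> seqs m n" unfolding b_def using seqs_range[OF zs gin(2)] by (rule restrict_seqs)
      have eq: "?G b = z"
      proof (rule seqs_eqI[OF G_seqs[OF b] zs])
        fix k assume "k \<in> {1..n}"
        then show "?G b k = z k" using gin(1)[of k] ginv by (simp add: b_def)
      qed
      have "b \<in> frankl_seqs m r t n" using z unfolding G_iff[OF b, symmetric] by (simp only: eq)
      then have "?G b \<in> ?G ` frankl_seqs m r t n" by (rule imageI)
      then show "z \<in> ?G ` frankl_seqs m r t n" by (simp only: eq)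
    qed
  qed
  ultimately show ?thesis unfolding isomorphic_def using f g(1) by (intro exI[of _ f] exI[of _ g]) auto
qed

end

text \<open>The condition \<open>n \<ge> t + 2\<close> makes the second alternative meaningful: for
  \<open>n = t + 1\<close> the family \<open>frankl_seqs m 1 t n\<close> is the single all-ones
  sequence, and for \<open>n = t\<close> it is empty.\<close>

theorem theorem5p1:
  fixes t m n :: nat and A B :: "(nat \<Rightarrow> nat) set"
  assumes "t \<ge> 14" and "m \<ge> t + 1" and "n \<ge> t"
    and "A \<subseteq> seqs m n" and "B \<subseteq> seqs m n"
    and "cross_intersecting t n A B"
  shows "card A * card B \<le> (m ^ (n - t))\<^sup>2 \<and>
    (card A * card B = (m ^ (n - t))\<^sup>2 \<longleftrightarrow>
       (A = B \<and> isomorphic m n A (frankl_seqs m 0 t n)) \<or>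
       (m = t + 1 \<and> n \<ge> t + 2 \<and> A = B \<and> isomorphic m n A (frankl_seqs m 1 t n)))"
proof -
  have "7 \<le> t" using assms(1) by simp
  then interpret sequence_space t m n
    using assms(2,3) by (rule sequence_space.intro)
  note bound = cross_intersecting_bound[OF assms(4-6)]
  \<comment> \<open>For the converse direction only sizes matter, and these are preserved by
    isomorphism.\<close>
  have iso: "card A = m ^ (n - t)"
    if "isomorphic m n A (frankl_seqs m r t n)" "t + 2 * r \<le> n" "r = 0 \<or> r = 1 \<and> m = t + 1" for r
  proof -
    have "frankl_seqs m r t n \<subseteq> seqs m n" unfolding frankl_seqs_def by blast
    then show ?thesis
      using isomorphic_card[OF assms(4) _ that(1)] card_frankl_seqs[OF that(2,3)] by simp
  qed
  have "isomorphic m n A (frankl_seqs m 0 t n) \<or>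
      m = t + 1 \<and> n \<ge> t + 2 \<and> isomorphic m n A (frankl_seqs m 1 t n)" if "extremal A"
  proof -
    obtain T c r where T: "T \<subseteq> {1..n}" "card T = t + 2 * r" "r = 0 \<or> r = 1 \<and> m = t + 1"
      "\<forall>k\<in>T. c k \<in> {1..m}" "A = pattern T c r"
      using \<open>extremal A\<close> unfolding extremal_def by blast
    have "isomorphic m n A (frankl_seqs m r t n)"
      unfolding T(5) by (rule isomorphic_pattern[OF T(1,2,4)])
    moreover have "t + 2 * r \<le> n" using card_ground[OF T(1)] T(2) by simp
    ultimately show ?thesis using T(3) by auto
  qed
  moreover have "card A * card B = (m ^ (n - t))\<^sup>2"
    if "A = B" "isomorphic m n A (frankl_seqs m 0 t n)"
    using iso[of 0] that assms(3) by (simp add: power2_eq_square)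
  moreover have "card A * card B = (m ^ (n - t))\<^sup>2"
    if "m = t + 1" "n \<ge> t + 2" "A = B" "isomorphic m n A (frankl_seqs m 1 t n)"
    using iso[of 1] that by (simp add: power2_eq_square)
  ultimately show ?thesis using bound by blast
qed

end
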